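(* Let $M$ be a $3$-connected matroid, let $N$ be a minor of $M$ without loops or coloops, let $\mathcal{T}$ be a tangle of $M$ of order at least $3$, let $X$ be a long line of the tangle matroid $M(\mathcal{T})$, and let $f\in X$. If $(X\setminus f)\cap E(N)=\emptyset$, then there exists $e\in X\setminus f$ such that either $M\setminus e$ or $M/ e$ is $3$-connected with $N$ as a minor.
   Context: $\lambda_M(X) = \rank_M(X) + \rank_M(E(M)\setminus X) - \rank(M)$. A tangle of order $\theta$ of $M$ is a collection $\mathcal{T}$ of subsets of $E(M)$ such that: (i) $\lambda_M(X)<\theta$ for all $X\in\mathcal{T}$; (ii) for every $X\subseteq E(M)$ with $\lambda_M(X)<\theta$, either $X\in\mathcal{T}$ or $E(M)\setminus X\in\mathcal{T}$; (iii) if $X,Y,Z\in\mathcal{T}$ then $X\cup Y\cup Z\neq E(M)$; (iv) $E(M)\setminus\{e\}\notin\mathcal{T}$ for every $e\in E(M)$. The tangle matroid $M(\mathcal{T})$ is the matroid on $E(M)$ with rank function $\rank_{\mathcal{T}}(X) = \min\{\lambda_M(Y): X\subseteq Y\in\mathcal{T}\}$ if some member of $\mathcal{T}$ contains $X$, and $\rank_{\mathcal{T}}(X)=\theta$ otherwise. A line of a matroid is a closed set of rank $2$; it is long if it has at least $3$ elements. "$M'$ has $N$ as a minor" means $N$ itself (with labelled ground set) equals $M'/C\setminus D$ for some disjoint $C,D\subseteq E(M')$. *)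

theory Defs
  imports Main
begin

text \<open>A matroid is represented by its ground set and its rank function
(values of the rank function outside subsets of the ground set are irrelevant).\<close>

type_synonym 'a matroid = "'a set \<times> ('a set \<Rightarrow> nat)"

definition gr :: "'a matroid \<Rightarrow> 'a set" where "gr M = fst M"
definition rk :: "'a matroid \<Rightarrow> 'a set \<Rightarrow> nat" where "rk M = snd M"

definition matroid :: "'a matroid \<Rightarrow> bool" where
  "matroid M \<longleftrightarrow> finite (gr M)
     \<and> (\<forall>X. X \<subseteq> gr M \<longrightarrow> rk M X \<le> card X)
     \<and> (\<forall>X Y. X \<subseteq> Y \<and> Y \<subseteq> gr M \<longrightarrow> rk M X \<le> rk M Y)
     \<and> (\<forall>X Y. X \<subseteq> gr M \<and> Y \<subseteq> gr M \<longrightarrow>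
            rk M (X \<union> Y) + rk M (X \<inter> Y) \<le> rk M X + rk M Y)"

definition conn :: "'a matroid \<Rightarrow> 'a set \<Rightarrow> nat" where
  "conn M X = rk M X + rk M (gr M - X) - rk M (gr M)"

definition k_separation :: "'a matroid \<Rightarrow> nat \<Rightarrow> 'a set \<Rightarrow> bool" where
  "k_separation M k X \<longleftrightarrow> X \<subseteq> gr M \<and> k \<le> card X \<and> k \<le> card (gr M - X) \<and> conn M X < k"

definition three_connected :: "'a matroid \<Rightarrow> bool" where
  "three_connected M \<longleftrightarrow> (\<forall>k. 1 \<le> k \<and> k < 3 \<longrightarrow> \<not> (\<exists>X. k_separation M k X))"

definition deletion :: "'a matroid \<Rightarrow> 'a \<Rightarrow> 'a matroid" where
  "deletion M e = (gr M - {e}, rk M)"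

definition contraction :: "'a matroid \<Rightarrow> 'a \<Rightarrow> 'a matroid" where
  "contraction M e = (gr M - {e}, \<lambda>X. rk M (X \<union> {e}) - rk M {e})"

definition is_minor :: "'a matroid \<Rightarrow> 'a matroid \<Rightarrow> bool" where
  "is_minor N M \<longleftrightarrow> (\<exists>C D. C \<inter> D = {} \<and> C \<union> D \<subseteq> gr M
      \<and> gr N = gr M - (C \<union> D)
      \<and> (\<forall>X. X \<subseteq> gr N \<longrightarrow> rk N X = rk M (X \<union> C) - rk M C))"

definition loop :: "'a matroid \<Rightarrow> 'a \<Rightarrow> bool" where
  "loop M e \<longleftrightarrow> e \<in> gr M \<and> rk M {e} = 0"

definition coloop :: "'a matroid \<Rightarrow> 'a \<Rightarrow> bool" where
  "coloop M e \<longleftrightarrow> e \<in> gr M \<and> rk M (gr M - {e}) < rk M (gr M)"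

definition tangle :: "'a matroid \<Rightarrow> nat \<Rightarrow> 'a set set \<Rightarrow> bool" where
  "tangle M \<theta> T \<longleftrightarrow> (\<forall>X\<in>T. X \<subseteq> gr M)
     \<and> (\<forall>X\<in>T. conn M X < \<theta>)
     \<and> (\<forall>X. X \<subseteq> gr M \<and> conn M X < \<theta> \<longrightarrow> X \<in> T \<or> gr M - X \<in> T)
     \<and> (\<forall>X\<in>T. \<forall>Y\<in>T. \<forall>Z\<in>T. X \<union> Y \<union> Z \<noteq> gr M)
     \<and> (\<forall>e\<in>gr M. gr M - {e} \<notin> T)"

definition tangle_rank :: "'a matroid \<Rightarrow> nat \<Rightarrow> 'a set set \<Rightarrow> 'a set \<Rightarrow> nat" where
  "tangle_rank M \<theta> T X = (if \<exists>Y\<in>T. X \<subseteq> Y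
      then Min {conn M Y | Y. Y \<in> T \<and> X \<subseteq> Y} else \<theta>)"

definition tangle_matroid :: "'a matroid \<Rightarrow> nat \<Rightarrow> 'a set set \<Rightarrow> 'a matroid" where
  "tangle_matroid M \<theta> T = (gr M, tangle_rank M \<theta> T)"

definition closed_set :: "'a matroid \<Rightarrow> 'a set \<Rightarrow> bool" where
  "closed_set M X \<longleftrightarrow> X \<subseteq> gr M \<and> (\<forall>e \<in> gr M - X. rk M (insert e X) \<noteq> rk M X)"

definition line :: "'a matroid \<Rightarrow> 'a set \<Rightarrow> bool" where
  "line M X \<longleftrightarrow> closed_set M X \<and> rk M X = 2"

definition long_line :: "'a matroid \<Rightarrow> 'a set \<Rightarrow> bool" where
  "long_line M X \<longleftrightarrow> line M X \<and> 3 \<le> card X"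

end

theory Submission
  imports Defs
begin

text \<open>
Write $E$ for the ground set of $M$ and $B = E \setminus X$. Since $X$ is a line of the tangle matroid,
$X$ itself belongs to the tangle, has connectivity $2$, and contains every $3$-separating member of
the tangle that meets it in two elements. Hence if $x$ is spanned by $X \setminus x$ and $M \setminus x$ is not
$3$-connected, then some $2$-separation of $M \setminus x$ has a side contained in $X \setminus x$; dually for $M / x$.

Fix a matroid $N_0 = M / C \setminus D$ with $C \cup D = X \setminus f$ that has $N$ as a minor and in which $f$ is neither a
loop nor a coloop: if $f \in E(N)$ this is immediate, and otherwise a refinement of Tutte's linking
theorem provides it. Suppose no element of $X \setminus f$ can be removed. Triangles and triads inside $X$
transfer deletability to contractibility of their elements and back, and Tutte's triangle lemma lets
any fan with four elements inside $X$ grow beyond each end that is not too close to $f$; since $X$ is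
finite, $X$ contains no such fan. An element that can be both deleted and contracted (keeping $N_0$)
lies in a triangle or triad by Bixby's argument, and a minimal $2$-separation side always
contains such an element or yields a triad directly. So $X$ contains a triangle or triad, which must contain
$f$, and a last look at the separation of one of its other elements gives a contradiction.
\<close>

section \<open>Rank functions\<close>

text \<open>Below, \<lambda>(Y) stands for \<open>r Y + r (E - Y) - r E\<close>. When
  \<open>f\<close> is not in \<open>E(N)\<close>, the minor \<open>N\<close> does not see
  \<open>X\<close> at all, and removing pieces of \<open>X\<close> may cut \<open>f\<close> off from
  \<open>E - X\<close> while \<open>N\<close> survives. The minor N_0 excludes this:
  \<open>f\<close> stays and is neither a loop nor a coloop, so it witnesses one unit of
  connectivity between \<open>X\<close> and the rest. Across a 2-separation this witness decides
  which exchanges of contracted elements leave N_0 unchanged.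

  The same N_0 usually arises from several contraction sets. Keeping all of them, as the family
  \<open>G\<close>, replaces minors by rank identities: showing that an element can be removed means
  turning one member of \<open>G\<close> into another that avoids it or contains it.

  The element \<open>f\<close> itself must never be removed. This is the obstacle behind the case
  distinctions: exchanges in triangles and triads need two elements other than \<open>f\<close>, and
  fans and separations are treated according to where \<open>f\<close> sits.\<close>

locale rank_function =
  fixes r :: "'a set \<Rightarrow> int"
  assumes rank_empty: "r {} = 0"
    and rank_mono: "S \<subseteq> T \<Longrightarrow> r S \<le> r T"
    and rank_submod: "r (S \<union> T) + r (S \<inter> T) \<le> r S + r T"
    and rank_insert_le: "r (insert x S) \<le> r S + 1"
begin

lemma submod_le: "U \<subseteq> S \<union> T \<Longrightarrow> V \<subseteq> S \<inter> T \<Longrightarrow> r U + r V \<le> r S + r T"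
  using rank_mono[of U "S \<union> T"] rank_mono[of V "S \<inter> T"] rank_submod[of S T] by linarith

lemma marginal_antimono: "S \<subseteq> T \<Longrightarrow> r (Y \<union> T) + r S \<le> r (Y \<union> S) + r T"
  by (rule submod_le) auto

lemma insert_marginal_antimono: "S \<subseteq> T \<Longrightarrow> r (insert x T) + r S \<le> r (insert x S) + r T"
  using marginal_antimono[of S T "{x}"] by simp

lemma insert_spanned_mono:
  assumes "S \<subseteq> T" "r (insert x S) \<le> r S" shows "r (insert x T) = r T"
  using insert_marginal_antimono[OF assms(1), of x] assms(2) rank_mono[OF subset_insertI, of T x] by linarith

lemma rank_nonneg: "0 \<le> r S"
  using rank_mono[of "{}" S] rank_empty by simp

lemma rank_union_le_card: "finite T \<Longrightarrow> r (S \<union> T) \<le> r S + int (card T)"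
proof (induction T rule: finite_induct)
  case (insert x T)
  then show ?case using rank_insert_le[of x "S \<union> T"] by simp
qed simp

lemma rank_le_card: "finite T \<Longrightarrow> r T \<le> int (card T)"
  using rank_union_le_card[of T "{}"] rank_empty by simp

lemma rank_pair_le: "r {x, y} \<le> 2"
  using rank_insert_le[of x "{y}"] rank_insert_le[of y "{}"] rank_empty by simp

lemma rank_singleton_le: "r {x} \<le> 1"
  using rank_insert_le[of x "{}"] rank_empty by simp

lemma skew_subset:
  assumes "r A + r B \<le> r (A \<union> B)" "A' \<subseteq> A" "B' \<subseteq> B"
  shows "r (A' \<union> B') = r A' + r B'"
proof -
  have "r (A \<union> B) + r A' \<le> r (A' \<union> B) + r A" using assms(2) by (intro submod_le) auto
  moreover have "r (A' \<union> B) + r B' \<le> r (A' \<union> B') + r B" using assms(3) by (intro submod_le) auto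
  moreover have "r (A' \<union> B') \<le> r A' + r B'"
    using rank_submod[of A' B'] rank_nonneg[of "A' \<inter> B'"] by linarith
  ultimately show ?thesis using assms(1) by linarith
qed

text \<open>Passing from \<open>C\<close> to a larger \<open>C'\<close> can only lower the ranks of
  a contraction, and the drop is monotone in the set measured. Without a drop on \<open>Q\<close>
  there is none on any subset of \<open>Q\<close>.\<close>

lemma same_contraction_on_subset:
  assumes "C \<subseteq> C'" "S \<subseteq> Q" "r (Q \<union> C) + r C' \<le> r (Q \<union> C') + r C"
  shows "r (S \<union> C) + r C' = r (S \<union> C') + r C"
proof -
  have "r (S \<union> C') + r C \<le> r (S \<union> C) + r C'" using assms by (intro submod_le) auto
  moreover have "r (Q \<union> C') + r (S \<union> C) \<le> r (Q \<union> C) + r (S \<union> C')"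
    using assms by (intro submod_le) auto
  ultimately show ?thesis using assms(3) by linarith
qed

lemma contract: "rank_function (\<lambda>S. r (insert x S) - r {x})"
proof
  fix S T
  have "insert x (S \<union> T) = insert x S \<union> insert x T" "insert x (S \<inter> T) = insert x S \<inter> insert x T"
    by auto
  then show "r (insert x (S \<union> T)) - r {x} + (r (insert x (S \<inter> T)) - r {x})
      \<le> r (insert x S) - r {x} + (r (insert x T) - r {x})"
    using rank_submod[of "insert x S" "insert x T"] by simp
next
  fix S T :: "'a set" assume "S \<subseteq> T"
  then show "r (insert x S) - r {x} \<le> r (insert x T) - r {x}"
    using rank_mono[of "insert x S" "insert x T"] by auto
next
  fix y S show "r (insert x (insert y S)) - r {x} \<le> r (insert x S) - r {x} + 1"
    using rank_insert_le[of y "insert x S"] by (simp add: insert_commute)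
qed simp

text \<open>The corank function. Intersecting with \<open>E\<close> in the cardinality term makes
  the rank axioms hold on all sets, as the locale demands.\<close>

definition dual :: "'a set \<Rightarrow> 'a set \<Rightarrow> int" where
  "dual E S = int (card (S \<inter> E)) + r (E - S) - r E"

lemma dual_rank_function:
  assumes "finite E" shows "rank_function (dual E)"
proof
  show "dual E {} = 0" by (simp add: dual_def)
next
  fix S T :: "'a set" assume "S \<subseteq> T"
  have "E - S \<subseteq> (E - T) \<union> ((T - S) \<inter> E)" by auto
  then have "r (E - S) \<le> r (E - T) + int (card ((T - S) \<inter> E))"
    using rank_mono[of "E - S" "(E - T) \<union> ((T - S) \<inter> E)"] assms
      rank_union_le_card[of "(T - S) \<inter> E" "E - T"] by simp
  moreover have "card (T \<inter> E) = card (S \<inter> E) + card ((T - S) \<inter> E)"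
    using assms \<open>S \<subseteq> T\<close>
    by (subst card_Un_disjoint[symmetric]) (auto intro: arg_cong[where f = card])
  ultimately show "dual E S \<le> dual E T" by (simp add: dual_def)
next
  fix S T
  have "card ((S \<union> T) \<inter> E) + card ((S \<inter> T) \<inter> E) = card (S \<inter> E) + card (T \<inter> E)"
    using card_Un_Int[of "S \<inter> E" "T \<inter> E"] assms
    by (simp add: Int_Un_distrib2 Int_assoc Int_left_commute)
  moreover have "r (E - (S \<union> T)) + r (E - (S \<inter> T)) \<le> r (E - S) + r (E - T)"
    by (subst add.commute, rule submod_le) auto
  ultimately show "dual E (S \<union> T) + dual E (S \<inter> T) \<le> dual E S + dual E T"
    by (simp add: dual_def)
next
  fix x S
  have "card (insert x S \<inter> E) \<le> card (insert x (S \<inter> E))"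
    using assms by (intro card_mono) auto
  also have "\<dots> \<le> Suc (card (S \<inter> E))" by (simp add: card_insert_le_m1 card_insert_if assms)
  finally have "card (insert x S \<inter> E) \<le> Suc (card (S \<inter> E))" .
  moreover have "r (E - insert x S) \<le> r (E - S)" by (rule rank_mono) auto
  ultimately show "dual E (insert x S) \<le> dual E S + 1" unfolding dual_def by linarith
qed

end

section \<open>Linking\<close>

text \<open>Tutte's linking theorem for a single element $f$ and the set $E \setminus X$, with the extra demand
that the minor on $E \setminus X$ obtained by contracting $C_0$ survives. The induction removes one element
of $X \setminus f$ at a time: if deleting it disconnects $f$ from $E \setminus X$, then it can be contracted without
losing that minor, and vice versa.\<close>

lemma linking_with_fixed_contraction:
  assumes "rank_function r" "finite E" "X \<subseteq> E" "f \<in> X" "C0 \<subseteq> X"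
    and "\<And>F. f \<in> F \<Longrightarrow> F \<subseteq> X \<Longrightarrow> r E < r F + r (E - F)"
  shows "\<exists>C A. C \<subseteq> X - {f} \<and> r (insert f C) = r C + 1
    \<and> r ((E - X) \<union> insert f C) = r ((E - X) \<union> C) \<and> (A = {} \<or> A = {f})
    \<and> (\<forall>Y \<subseteq> E - X. r (Y \<union> (C \<union> A)) + r C0 = r (Y \<union> C0) + r (C \<union> A))"
  using assms
proof (induction "card X" arbitrary: r E X C0 rule: less_induct)
  case less
  interpret rank_function r by fact
  let ?B = "E - X"
  have conn: "r E < r F + r (E - F)" if "f \<in> F" "F \<subseteq> X" for F using less.prems(6) that by blast
  have finX: "finite X" using less.prems finite_subset by blast
  define G where "G = {C. C \<subseteq> X \<and> (\<forall>Y \<subseteq> ?B. r (Y \<union> C) + r C0 = r (Y \<union> C0) + r C)}"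
  have C0G: "C0 \<in> G" using less.prems by (auto simp: G_def)
  have G_D: "C \<subseteq> X" "Y \<subseteq> ?B \<Longrightarrow> r (Y \<union> C) + r C0 = r (Y \<union> C0) + r C" if "C \<in> G" for C Y
    using that by (auto simp: G_def)
  have G_trans: "C' \<in> G"
    if C: "C \<in> G" "C' \<subseteq> X" and eq: "\<And>Y. Y \<subseteq> ?B \<Longrightarrow> r (Y \<union> C') + r C = r (Y \<union> C) + r C'" for C C'
  proof -
    have "r (Y \<union> C') + r C0 = r (Y \<union> C0) + r C'" if "Y \<subseteq> ?B" for Y
      using G_D(2)[OF C(1) that] eq[OF that] by linarith
    then show ?thesis using C(2) by (simp add: G_def)
  qed
  show ?case
  proof (cases "X = {f}")
    case True
    have "r E < r {f} + r (E - {f})" using conn[of "{f}"] True by simp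
    moreover have "r (E - {f}) \<le> r E" by (rule rank_mono) auto
    moreover have "insert f (E - {f}) = E" using less.prems by auto
    ultimately have "r {f} = 1" "r (insert f (E - {f})) = r (E - {f})"
      using rank_singleton_le[of f] by auto
    \<comment> \<open>Here \<open>A\<close> is \<open>C0\<close> itself: \<open>f\<close> is
      contracted or deleted as \<open>C0\<close> prescribes.\<close>
    then show ?thesis using less.prems(5) True rank_empty
      by (intro exI[of _ "{}"] exI[of _ C0]) auto
  next
    case False
    then obtain x where x: "x \<in> X" "x \<noteq> f" using less.prems(4) by auto
    have xE: "x \<in> E" using x less.prems(3) by auto
    define nsd where "nsd \<longleftrightarrow> (\<forall>F. f \<in> F \<and> F \<subseteq> X - {x} \<longrightarrow> r (E - {x}) < r F + r (E - {x} - F))"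
    define nsc where "nsc \<longleftrightarrow> (\<forall>F. f \<in> F \<and> F \<subseteq> X - {x} \<longrightarrow> r E + r {x} < r (insert x F) + r (E - F))"
    have rx: "r (E - {x}) \<le> r E" by (rule rank_mono) auto
    \<comment> \<open>A set \<open>F1\<close> cutting off \<open>f\<close> after deleting
      \<open>x\<close> and a set \<open>F2\<close> doing so after contracting \<open>x\<close>
      uncross to \<open>F1 \<inter> F2\<close> and \<open>F1 \<union> F2 \<union> {x}\<close>. Both
      have \<lambda> at least 1, whereas their sum is at most 1.\<close>
    have ns: "nsd \<or> nsc"
    proof (rule ccontr)
      assume "\<not> ?thesis"
      then obtain F1 F2 where F: "f \<in> F1" "F1 \<subseteq> X - {x}" "f \<in> F2" "F2 \<subseteq> X - {x}"
        "r F1 + r (E - {x} - F1) \<le> r (E - {x})" "r (insert x F2) + r (E - F2) \<le> r E + r {x}"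
        unfolding nsd_def nsc_def by (meson not_less)
      have "r (F1 \<union> insert x F2) + r (F1 \<inter> F2) \<le> r F1 + r (insert x F2)"
        by (rule submod_le) auto
      moreover have "r (E - (F1 \<inter> F2)) + r (E - (F1 \<union> insert x F2)) \<le> r (E - {x} - F1) + r (E - F2)"
        by (rule submod_le) (use F in auto)
      moreover have "r E < r (F1 \<inter> F2) + r (E - (F1 \<inter> F2))" using F by (intro conn) auto
      moreover have "r E < r (F1 \<union> insert x F2) + r (E - (F1 \<union> insert x F2))"
        using F x by (intro conn) auto
      ultimately show False using F rx rank_singleton_le[of x] by linarith
    qed
    \<comment> \<open>If deleting \<open>x\<close> cuts off \<open>F\<close>, the part of
      \<open>C0\<close> in \<open>F\<close> has no effect outside \<open>F\<close>, and
      \<open>x\<close> is a coloop of the restriction to \<open>E - F\<close>; contracting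
      \<open>x\<close> there is the same as deleting it.\<close>
    have c2: "\<exists>C\<in>G. x \<in> C" if sep: "\<not> nsd"
    proof -
      obtain F where F: "f \<in> F" "F \<subseteq> X - {x}" "r F + r (E - {x} - F) \<le> r (E - {x})"
        using sep unfolding nsd_def by (meson not_less)
      let ?R = "E - {x} - F"
      have "F \<union> ?R = E - {x}" using F less.prems(3) by auto
      then have FR: "r F + r ?R \<le> r (F \<union> ?R)" using F by simp
      have "r E < r F + r (E - F)" using F by (intro conn) auto
      moreover have "E - F = insert x ?R" using F xE by auto
      ultimately have xR: "r ?R + 1 \<le> r (insert x ?R)" using F rx by simp
      show ?thesis
      proof (cases "x \<in> C0")
        case False
        let ?C = "C0 - F"
        have "r (Y \<union> C0) = r (C0 \<inter> F) + r (Y \<union> ?C)" if "Y \<subseteq> ?B" for Y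
        proof -
          have "Y \<union> C0 = (C0 \<inter> F) \<union> (Y \<union> ?C)" by auto
          moreover have "Y \<union> ?C \<subseteq> ?R" using that F less.prems(3,5) False x by auto
          ultimately show ?thesis using skew_subset[OF FR, of "C0 \<inter> F" "Y \<union> ?C"] by simp
        qed
        note e = this
        have e2: "r (insert x S) = r S + 1" if "S \<subseteq> ?R" for S
          using insert_marginal_antimono[OF that, of x] xR rank_insert_le[of x S] by linarith
        have "r (Y \<union> insert x ?C) + r C0 = r (Y \<union> C0) + r (insert x ?C)" if "Y \<subseteq> ?B" for Y
        proof -
          have "r (insert x (Y \<union> ?C)) = r (Y \<union> ?C) + 1" "r (insert x ?C) = r ?C + 1"
            using that less.prems x F False by (auto intro!: e2)
          then show ?thesis using e[OF that] e[of "{}"] by simp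
        qed
        then have "insert x ?C \<in> G" using less.prems(5) x by (auto simp: G_def)
        then show ?thesis by blast
      qed (use C0G in auto)
    qed
    \<comment> \<open>Dually, \<open>F\<close> spans \<open>x\<close> and is a separator after
      contracting \<open>x\<close>. Contracting all of \<open>F\<close> turns \<open>x\<close> into
      a loop, which may leave the contraction set, and changes nothing outside
      \<open>F\<close>.\<close>
    have c3: "\<exists>C\<in>G. x \<notin> C" if sep: "\<not> nsc"
    proof -
      obtain F where F: "f \<in> F" "F \<subseteq> X - {x}" "r (insert x F) + r (E - F) \<le> r E + r {x}"
        using sep unfolding nsc_def by (meson not_less)
      let ?R = "E - {x} - F"
      have "r E < r F + r (E - F)" using F by (intro conn) auto
      then have xF: "r (insert x F) \<le> r F" using F rank_singleton_le[of x] by linarith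
      interpret c: rank_function "\<lambda>S. r (insert x S) - r {x}" by (rule contract)
      have eqs: "insert x ?R = E - F" "insert x (F \<union> ?R) = E" using F xE less.prems(3) by auto
      then have FR: "(r (insert x F) - r {x}) + (r (insert x ?R) - r {x}) \<le> r (insert x (F \<union> ?R)) - r {x}"
        using F by simp
      show ?thesis
      proof (cases "x \<in> C0")
        case True
        let ?C = "(C0 - {x}) \<union> F"
        have "r (Y \<union> ?C) = r (insert x F) + r (insert x (Y \<union> (C0 - F))) - r {x}
            \<and> r (Y \<union> C0) = r (insert x (F \<inter> C0)) + r (insert x (Y \<union> (C0 - F))) - r {x}"
          if "Y \<subseteq> ?B" for Y
        proof -
          let ?S = "Y \<union> (C0 - {x} - F)"
          have S: "?S \<subseteq> ?R" using that F less.prems x by auto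
          have "insert x (F \<union> ?S) = insert x (Y \<union> ?C)" "insert x (F \<inter> C0 \<union> ?S) = Y \<union> C0"
            "insert x ?S = insert x (Y \<union> (C0 - F))" using True by auto
          moreover have "r (insert x (Y \<union> ?C)) = r (Y \<union> ?C)"
            by (rule insert_spanned_mono[OF _ xF]) auto
          ultimately show ?thesis
            using c.skew_subset[OF FR _ S, of F] c.skew_subset[OF FR _ S, of "F \<inter> C0"] by auto
        qed
        from this this[of "{}"]
        have "r (Y \<union> ?C) + r C0 = r (Y \<union> C0) + r ?C" if "Y \<subseteq> ?B" for Y using that by simp
        then have "?C \<in> G" using less.prems(5) F by (auto simp: G_def)
        moreover have "x \<notin> ?C" using F(2) by auto
        ultimately show ?thesis by metis
      qed (use C0G in auto)
    qed
    have lt: "card (X - {x}) < card X" using finX x by (meson card_Diff1_less)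
    have EB: "E - {x} - (X - {x}) = ?B" using x by auto
    have sub: "X - {x} \<subseteq> E - {x}" "f \<in> X - {x}" "finite (E - {x})" using less.prems x by auto
    \<comment> \<open>If both removals keep the connectivity, \<open>C0\<close> decides between
      them; otherwise the failing one provides the contraction set for the other.\<close>
    consider C where "nsd" "C \<in> G" "x \<notin> C" | C where "nsc" "C \<in> G" "x \<in> C"
      using ns c2 c3 C0G by metis
    then show ?thesis
    proof cases
      case 1
      have C: "C \<subseteq> X - {x}" using 1 by (auto simp: G_def)
      have ns': "r (E - {x}) < r F + r (E - {x} - F)" if "f \<in> F" "F \<subseteq> X - {x}" for F
        using 1(1) that unfolding nsd_def by auto
      define L where "L C' A \<longleftrightarrow> C' \<subseteq> X - {x} - {f} \<and> r (insert f C') = r C' + 1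
          \<and> r (?B \<union> insert f C') = r (?B \<union> C') \<and> (A = {} \<or> A = {f})
          \<and> (\<forall>Y \<subseteq> ?B. r (Y \<union> (C' \<union> A)) + r C = r (Y \<union> C) + r (C' \<union> A))" for C' A
      have "\<exists>C' A. L C' A"
        unfolding L_def by (rule less.hyps[of "X - {x}" r "E - {x}" C, OF lt less.prems(1) sub(3) sub(1) sub(2) C ns', unfolded EB])
      then obtain C' A where "L C' A" by blast
      then have C': "C' \<subseteq> X - {x} - {f}" "r (insert f C') = r C' + 1"
          "r (?B \<union> insert f C') = r (?B \<union> C')" "A = {} \<or> A = {f}"
          "\<And>Y. Y \<subseteq> ?B \<Longrightarrow> r (Y \<union> (C' \<union> A)) + r C = r (Y \<union> C) + r (C' \<union> A)"
        unfolding L_def by simp_all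
      have "C' \<union> A \<subseteq> X" using C' less.prems(4) by auto
      then have "C' \<union> A \<in> G" using G_trans[OF 1(2) _ C'(5)] by simp
      note CA = G_D(2)[OF this]
      show ?thesis
      proof (intro exI conjI allI impI)
        show "C' \<subseteq> X - {f}" using C' by auto
        show "r (insert f C') = r C' + 1" "r (?B \<union> insert f C') = r (?B \<union> C')" "A = {} \<or> A = {f}"
          using C' by auto
      qed (rule CA)
    next
      case 2
      have C: "C - {x} \<subseteq> X - {x}" using 2 by (auto simp: G_def)
      let ?r = "\<lambda>S. r (insert x S) - r {x}"
      have ns': "?r (E - {x}) < ?r F + ?r (E - {x} - F)" if "f \<in> F" "F \<subseteq> X - {x}" for F
      proof -
        have "insert x (E - {x} - F) = E - F" "insert x (E - {x}) = E" using that xE by auto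
        then show ?thesis using 2(1) that unfolding nsc_def by auto
      qed
      define L where "L C' A \<longleftrightarrow> C' \<subseteq> X - {x} - {f} \<and> ?r (insert f C') = ?r C' + 1
          \<and> ?r (?B \<union> insert f C') = ?r (?B \<union> C') \<and> (A = {} \<or> A = {f})
          \<and> (\<forall>Y \<subseteq> ?B. ?r (Y \<union> (C' \<union> A)) + ?r (C - {x}) = ?r (Y \<union> (C - {x})) + ?r (C' \<union> A))" for C' A
      have "\<exists>C' A. L C' A"
        unfolding L_def by (rule less.hyps[of "X - {x}" ?r "E - {x}" "C - {x}", OF lt contract sub(3) sub(1) sub(2) C ns', unfolded EB])
      then obtain C' A where "L C' A" by blast
      then have C': "C' \<subseteq> X - {x} - {f}" "?r (insert f C') = ?r C' + 1"
          "?r (?B \<union> insert f C') = ?r (?B \<union> C')" "A = {} \<or> A = {f}"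
          "\<And>Y. Y \<subseteq> ?B \<Longrightarrow> ?r (Y \<union> (C' \<union> A)) + ?r (C - {x}) = ?r (Y \<union> (C - {x})) + ?r (C' \<union> A)"
        unfolding L_def by simp_all
      have ix: "insert x (C - {x}) = C" "insert x (Y \<union> (C - {x})) = Y \<union> C" for Y using 2 by auto
      have "r (Y \<union> (insert x C' \<union> A)) + r C = r (Y \<union> C) + r (insert x C' \<union> A)" if "Y \<subseteq> ?B" for Y
        using C'(5)[OF that] by (simp add: ix insert_absorb[OF 2(3)])
      moreover have "insert x C' \<union> A \<subseteq> X" using C' less.prems(4) x by auto
      ultimately have "insert x C' \<union> A \<in> G" using G_trans[OF 2(2)] by simp
      note CA = G_D(2)[OF this]
      show ?thesis
      proof (intro exI conjI allI impI)
        show "insert x C' \<subseteq> X - {f}" using C' x by auto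
        show "r (insert f (insert x C')) = r (insert x C') + 1" "A = {} \<or> A = {f}"
          using C' by (auto simp: insert_commute)
        show "r (?B \<union> insert f (insert x C')) = r (?B \<union> insert x C')"
          using C'(3) by (simp add: insert_commute)
      qed (rule CA)
    qed
  qed
qed

section \<open>Separations inside the line\<close>

text \<open>If \<open>x\<close> is not a coloop, this says that \<lambda>(P) \<le> 1 in the deletion
  of \<open>x\<close>. Only \<open>P\<close> carries a size bound, because the other side contains
  \<open>E - X\<close>.\<close>

definition del_separation :: "('a set \<Rightarrow> int) \<Rightarrow> 'a set \<Rightarrow> 'a set \<Rightarrow> 'a \<Rightarrow> 'a set \<Rightarrow> bool" where
  "del_separation r E X x P \<longleftrightarrow>
     x \<notin> P \<and> insert x P \<subseteq> X \<and> 2 \<le> card P \<and> r P + r (E - P - {x}) \<le> r E + 1"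

text \<open>The constant is 2 because all three sets contain \<open>x\<close>: with
  \<open>r {x} = 1\<close>, each of the ranks drops by 1 in the contraction.\<close>

definition con_separation :: "('a set \<Rightarrow> int) \<Rightarrow> 'a set \<Rightarrow> 'a set \<Rightarrow> 'a \<Rightarrow> 'a set \<Rightarrow> bool" where
  "con_separation r E X x P \<longleftrightarrow>
     x \<notin> P \<and> insert x P \<subseteq> X \<and> 2 \<le> card P \<and> r (insert x P) + r (E - P) \<le> r E + 2"

context rank_function
begin

lemma dual_eq: "S \<subseteq> E \<Longrightarrow> dual E S = int (card S) + r (E - S) - r E"
  by (simp add: dual_def inf.absorb1)

lemma dual_compl_eq:
  assumes "finite E" "S \<subseteq> E" shows "dual E (E - S) = int (card E) - int (card S) + r S - r E"
proof -
  have "E - (E - S) = S" "card S \<le> card E" using assms by (auto intro: card_mono)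
  then show ?thesis using assms by (subst dual_eq) (auto simp: card_Diff_subset finite_subset)
qed

lemma dual_lambda:
  assumes "finite E" "S \<subseteq> E"
  shows "dual E S + dual E (E - S) - dual E E = r S + r (E - S) - r E"
  using dual_eq[OF assms(2)] dual_compl_eq[OF assms] dual_eq[of E E] rank_empty by simp

lemma dual_del_separation:
  assumes "finite E" "X \<subseteq> E"
  shows "del_separation (dual E) E X x P \<longleftrightarrow> con_separation r E X x P"
proof (cases "x \<notin> P \<and> insert x P \<subseteq> X")
  case True
  then have s: "P \<subseteq> E" "insert x P \<subseteq> E" "E - P - {x} = E - insert x P" "finite P" "E - P = insert x (E - insert x P)"
    using assms by (auto intro: rev_finite_subset)
  have "dual E P + dual E (E - P - {x}) = r (E - P) + r (insert x P) - 2 * r E + int (card E) - 1"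
    unfolding s(3) dual_compl_eq[OF assms(1) s(2)] dual_eq[OF s(1)] using True s(4) by simp
  then show ?thesis unfolding del_separation_def con_separation_def
    using dual_eq[of E E] rank_empty by auto
qed (auto simp: del_separation_def con_separation_def)

lemma dual_con_separation:
  assumes "finite E" "X \<subseteq> E"
  shows "con_separation (dual E) E X x P \<longleftrightarrow> del_separation r E X x P"
proof (cases "x \<notin> P \<and> insert x P \<subseteq> X")
  case True
  then have s: "P \<subseteq> E" "insert x P \<subseteq> E" "E - P - {x} = E - insert x P" "finite P"
    using assms by (auto intro: rev_finite_subset)
  have "dual E (insert x P) + dual E (E - P) = r P + r (E - P - {x}) - 2 * r E + int (card E) + 1"
    unfolding s(3) dual_compl_eq[OF assms(1) s(1)] dual_eq[OF s(2)] using True s(4) by simp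
  then show ?thesis unfolding del_separation_def con_separation_def
    using dual_eq[of E E] rank_empty by auto
qed (auto simp: del_separation_def con_separation_def)

end

text \<open>A hypothetical counterexample, reduced to its rank function: \<open>G\<close> consists of the sets
$C \subseteq X \setminus f$ for which contracting $C$ and deleting the rest of $X \setminus f$ gives the fixed minor $N_0$.
The assumptions are invariant under duality.\<close>

locale obstruction = rank_function r for r :: "'a set \<Rightarrow> int" +
  fixes E X :: "'a set" and f :: 'a and G :: "'a set set"
  assumes finE: "finite E" and XE: "X \<subseteq> E" and fX: "f \<in> X"
    and conn2: "Y \<subseteq> X \<Longrightarrow> 2 \<le> card Y \<Longrightarrow> r E + 2 \<le> r Y + r (E - Y)"
    and conn1: "x \<in> X \<Longrightarrow> r E + 1 \<le> r {x} + r (E - {x})"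
    and connX: "r X + r (E - X) \<le> r E + 2"
    and cardX: "3 \<le> card X"
    and G_nonempty: "G \<noteq> {}"
    and G_sub: "C \<in> G \<Longrightarrow> C \<subseteq> X - {f}"
    and G_nonloop: "C \<in> G \<Longrightarrow> r (insert f C) = r C + 1"
    and G_noncoloop: "C \<in> G \<Longrightarrow> r (insert f ((E - X) \<union> C)) = r ((E - X) \<union> C)"
    and G_closed: "C \<in> G \<Longrightarrow> C' \<subseteq> X - {f}
      \<Longrightarrow> (\<And>Y. Y \<subseteq> insert f (E - X) \<Longrightarrow> r (Y \<union> C') + r C = r (Y \<union> C) + r C') \<Longrightarrow> C' \<in> G"
    and del_sep: "C \<in> G \<Longrightarrow> x \<in> X - {f} \<Longrightarrow> x \<notin> C \<Longrightarrow> r (X - {x}) = r X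
      \<Longrightarrow> \<exists>P. del_separation r E X x P"
    and con_sep: "C \<in> G \<Longrightarrow> x \<in> C \<Longrightarrow> r (insert x (E - X)) = r (E - X) + 1
      \<Longrightarrow> \<exists>P. con_separation r E X x P"
begin

text \<open>Contracting \<open>C\<close> and deleting the rest of \<open>X - {f}\<close> is, in the
  dual, contracting the rest and deleting \<open>C\<close>. So complementing the members of
  \<open>G\<close> in \<open>X - {f}\<close> exchanges loops with coloops and \<open>del_sep\<close>
  with \<open>con_sep\<close>, and every result about deletion gets a twin about
  contraction.\<close>

lemma dual_obstruction: "obstruction (dual E) E X f ((\<lambda>C. X - {f} - C) ` G)"
proof -
  interpret d: rank_function "dual E" by (rule dual_rank_function[OF finE])
  show ?thesis
  proof
    show "finite E" "X \<subseteq> E" "f \<in> X" "3 \<le> card X" "(\<lambda>C. X - {f} - C) ` G \<noteq> {}"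
      using finE XE fX cardX G_nonempty by auto
  next
    fix Y assume "Y \<subseteq> X" "2 \<le> card Y"
    then show "dual E E + 2 \<le> dual E Y + dual E (E - Y)"
      using dual_lambda[OF finE, of Y] conn2[of Y] XE by force
  next
    fix x assume "x \<in> X"
    then show "dual E E + 1 \<le> dual E {x} + dual E (E - {x})"
      using dual_lambda[OF finE, of "{x}"] conn1[of x] XE by auto
  next
    show "dual E X + dual E (E - X) \<le> dual E E + 2"
      using dual_lambda[OF finE XE] connX by simp
  next
    fix C assume "C \<in> (\<lambda>C. X - {f} - C) ` G"
    then show "C \<subseteq> X - {f}" by auto
  next
    fix C assume "C \<in> (\<lambda>C. X - {f} - C) ` G"
    then obtain C' where C': "C' \<in> G" "C = X - {f} - C'" by auto
    have s: "C \<subseteq> E" "insert f C \<subseteq> E" "f \<notin> C" "E - insert f C = (E - X) \<union> C'"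
      "E - C = insert f ((E - X) \<union> C')" "finite C"
      using C' G_sub[OF C'(1)] XE fX finE finite_subset[of C E] by auto
    then show "dual E (insert f C) = dual E C + 1"
      using G_noncoloop[OF C'(1)] by (simp add: dual_eq)
    have e: "(E - X) \<union> C = E - insert f C'" "insert f ((E - X) \<union> C) = E - C'" "insert f C' \<subseteq> E" "C' \<subseteq> E"
      "f \<notin> C'" using C' G_sub[OF C'(1)] XE fX by auto
    then show "dual E (insert f ((E - X) \<union> C)) = dual E ((E - X) \<union> C)"
      using G_nonloop[OF C'(1)] finite_subset[OF e(4) finE]
      unfolding e(1,2) by (simp add: dual_compl_eq[OF finE])
  next
    fix C1 C2 assume "C1 \<in> (\<lambda>C. X - {f} - C) ` G" and C2: "C2 \<subseteq> X - {f}"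
      and eq: "\<And>Y. Y \<subseteq> insert f (E - X) \<Longrightarrow> dual E (Y \<union> C2) + dual E C1 = dual E (Y \<union> C1) + dual E C2"
    then obtain C1' where C1': "C1' \<in> G" "C1 = X - {f} - C1'" by auto
    let ?C2' = "X - {f} - C2" and ?U = "insert f (E - X)"
    have C1'X: "C1' \<subseteq> X - {f}" using G_sub C1' by blast
    have fin: "finite C1" "finite C2" using C1' C2 finite_subset[OF XE finE] by (auto intro: finite_subset)
    have e: "r (Y \<union> ?C2') + r (?U \<union> C1') = r (Y \<union> C1') + r (?U \<union> ?C2')" if Y: "Y \<subseteq> ?U" for Y
    proof -
      have s: "?U - Y \<union> C2 \<subseteq> E" "?U - Y \<union> C1 \<subseteq> E" "C1 \<subseteq> E" "C2 \<subseteq> E"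
        "(?U - Y) \<inter> C2 = {}" "(?U - Y) \<inter> C1 = {}" "finite (?U - Y)"
        "E - C1 = ?U \<union> C1'" "E - C2 = ?U \<union> ?C2'"
        "E - (?U - Y \<union> C1) = Y \<union> C1'" "E - (?U - Y \<union> C2) = Y \<union> ?C2'"
        using XE fX C2 C1' C1'X Y finE by auto
      show ?thesis using eq[of "?U - Y"] unfolding dual_eq[OF s(1)] dual_eq[OF s(2)] dual_eq[OF s(3)]
          dual_eq[OF s(4)] card_Un_disjoint[OF s(7) fin(2) s(5)] card_Un_disjoint[OF s(7) fin(1) s(6)]
          s(8-11) by auto
    qed
    have "r (Y \<union> ?C2') + r C1' = r (Y \<union> C1') + r ?C2'" if "Y \<subseteq> ?U" for Y
      using e[OF that] e[of "{}"] by simp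
    then have "?C2' \<in> G" using G_closed[OF C1'(1), of ?C2'] by auto
    moreover have "C2 = X - {f} - ?C2'" using C2 by auto
    ultimately show "C2 \<in> (\<lambda>C. X - {f} - C) ` G" by (rule image_eqI[rotated])
  next
    fix C x assume "C \<in> (\<lambda>C. X - {f} - C) ` G" and x: "x \<in> X - {f}" "x \<notin> C"
      and eq: "dual E (X - {x}) = dual E X"
    then obtain C' where C': "C' \<in> G" "x \<in> C'" by auto
    have "E - (X - {x}) = insert x (E - X)" "X - {x} \<subseteq> E" "finite X" using x XE finE finite_subset by auto
    then have "r (insert x (E - X)) = r (E - X) + 1"
      using eq x XE card_Suc_Diff1[of X x] by (simp add: dual_eq)
    then show "\<exists>P. del_separation (dual E) E X x P"
      using con_sep[OF C'] by (simp add: dual_del_separation[OF finE XE])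
  next
    fix C x assume "C \<in> (\<lambda>C. X - {f} - C) ` G" and x: "x \<in> C"
      and eq: "dual E (insert x (E - X)) = dual E (E - X) + 1"
    then obtain C' where C': "C' \<in> G" "x \<in> X - {f}" "x \<notin> C'" by auto
    have s: "insert x (E - X) = E - (X - {x})" "X - {x} \<subseteq> E" "finite X"
      using C' XE finE finite_subset by auto
    have "r (X - {x}) = r X"
      using eq C' card_Suc_Diff1[of X x] s(3) unfolding s(1) dual_compl_eq[OF finE s(2)] dual_compl_eq[OF finE XE]
      by simp
    then show "\<exists>P. con_separation (dual E) E X x P"
      using del_sep[OF C'] by (simp add: dual_con_separation[OF finE XE])
  qed
qed

text \<open>For \<open>x\<close> in \<open>X - {f}\<close> this encodes that the deletion of
  \<open>x\<close> still has N_0 as a minor. Both \<open>del x\<close> and \<open>con x\<close> may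
  hold. Members of \<open>G\<close> avoid \<open>f\<close>, so \<open>del f\<close> is always true
  and \<open>con f\<close> always false; hence the conditions \<open>x \<noteq> f\<close> later
  on.\<close>

definition del :: "'a \<Rightarrow> bool" where "del x \<longleftrightarrow> (\<exists>C\<in>G. x \<notin> C)"

definition con :: "'a \<Rightarrow> bool" where "con x \<longleftrightarrow> (\<exists>C\<in>G. x \<in> C)"

definition triangle :: "'a \<Rightarrow> 'a \<Rightarrow> 'a \<Rightarrow> bool" where
  "triangle a b c \<longleftrightarrow> distinct [a, b, c] \<and> {a, b, c} \<subseteq> X \<and> r {a, b, c} \<le> 2"

definition triad :: "'a \<Rightarrow> 'a \<Rightarrow> 'a \<Rightarrow> bool" where
  "triad a b c \<longleftrightarrow> distinct [a, b, c] \<and> {a, b, c} \<subseteq> X \<and> r (E - {a, b, c}) \<le> r E - 1"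

lemma del_or_con: "del x \<or> con x"
  using G_nonempty by (auto simp: del_def con_def)

end

section \<open>Self-duality of triangles and triads, and small connectivity inside the line\<close>

context obstruction
begin

interpretation d: obstruction "dual E" E X f "(\<lambda>C. X - {f} - C) ` G" by (rule dual_obstruction)

lemma dual_triangle: "d.triangle = triad"
proof (intro ext)
  fix a b c
  show "d.triangle a b c = triad a b c"
  proof (cases "distinct [a, b, c] \<and> {a, b, c} \<subseteq> X")
    case True
    then have "{a, b, c} \<subseteq> E" using XE by auto
    then show ?thesis using True by (auto simp: d.triangle_def triad_def dual_eq)
  qed (auto simp: d.triangle_def triad_def)
qed

lemma dual_triad: "d.triad = triangle"
proof (intro ext)
  fix a b c
  show "d.triad a b c = triangle a b c"
  proof (cases "distinct [a, b, c] \<and> {a, b, c} \<subseteq> X")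
    case True
    then have "{a, b, c} \<subseteq> E" using XE by auto
    then show ?thesis using True dual_eq[of E E] rank_empty dual_compl_eq[OF finE, of "{a, b, c}"]
      unfolding d.triad_def triangle_def by auto
  qed (auto simp: d.triad_def triangle_def)
qed

lemma dual_con: "x \<in> X - {f} \<Longrightarrow> d.con x = del x"
  by (auto simp: d.con_def del_def)

lemma dual_del: "x \<in> X - {f} \<Longrightarrow> d.del x = con x"
  by (auto simp: d.del_def con_def)

lemma triangle_perms:
  assumes "triangle a b c"
  shows "triangle a c b" "triangle b a c" "triangle b c a" "triangle c a b" "triangle c b a"
  using assms by (auto simp: triangle_def insert_commute)

lemma triad_perms:
  assumes "triad a b c"
  shows "triad a c b" "triad b a c" "triad b c a" "triad c a b" "triad c b a"
  using assms by (auto simp: triad_def insert_commute)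

lemma triangleD: "triangle a b c \<Longrightarrow> a \<in> X \<and> b \<in> X \<and> c \<in> X \<and> a \<noteq> b \<and> a \<noteq> c \<and> b \<noteq> c"
  by (auto simp: triangle_def)

lemma triadD: "triad a b c \<Longrightarrow> a \<in> X \<and> b \<in> X \<and> c \<in> X \<and> a \<noteq> b \<and> a \<noteq> c \<and> b \<noteq> c"
  by (auto simp: triad_def)

lemma finX: "finite X" using XE finE by (rule finite_subset)

lemma rank_singleton: "x \<in> X \<Longrightarrow> r {x} = 1"
  using conn1[of x] rank_singleton_le[of x] rank_mono[of "E - {x}" E] by auto

lemma rank_del_singleton: "x \<in> X \<Longrightarrow> r (E - {x}) = r E"
  using conn1[of x] rank_singleton_le[of x] rank_mono[of "E - {x}" E] by auto

lemma rank_pair: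
  assumes "x \<in> X" "y \<in> X" "x \<noteq> y" shows "r {x, y} = 2" "r (E - {x, y}) = r E"
proof -
  have "r E + 2 \<le> r {x, y} + r (E - {x, y})" using assms by (intro conn2) auto
  moreover have "r (E - {x, y}) \<le> r E" by (rule rank_mono) auto
  ultimately show "r {x, y} = 2" "r (E - {x, y}) = r E" using rank_pair_le[of x y] by auto
qed

lemma conn_nonempty:
  assumes "Y \<subseteq> X" "Y \<noteq> {}" shows "r E + 1 \<le> r Y + r (E - Y)"
proof (cases "2 \<le> card Y")
  case False
  moreover have "card Y \<noteq> 0" using assms rev_finite_subset[OF finX] by auto
  ultimately have "card Y = 1" by linarith
  then show ?thesis using assms conn1 by (auto simp: card_1_singleton_iff)
next
  case True
  then show ?thesis using conn2[OF assms(1)] by linarith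
qed

lemma conn_small:
  assumes "Y \<subseteq> X" "r Y + r (E - Y) \<le> r E + 1" shows "Y = {} \<or> (\<exists>t. Y = {t})"
proof -
  have "card Y < 2" using conn2[OF assms(1)] assms(2) by linarith
  then have "card Y = 0 \<or> card Y = 1" by auto
  then show ?thesis using assms rev_finite_subset[OF finX] by (auto simp: card_1_singleton_iff)
qed

lemma card2_mono: "2 \<le> card P \<Longrightarrow> P \<subseteq> Z \<Longrightarrow> Z \<subseteq> X \<Longrightarrow> 2 \<le> card Z"
  using card_mono[of Z P] rev_finite_subset[OF finX, of Z] by linarith

lemma card2_remove_nonempty:
  assumes "2 \<le> card P" shows "P - {b} \<noteq> {}"
proof
  assume "P - {b} = {}"
  then have "P \<subseteq> {b}" by auto
  then show False using card_mono[of "{b}" P] assms by simp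
qed

lemma triangle_span:
  assumes "triangle a b c" "b \<in> S" "c \<in> S" shows "r (insert a S) = r S"
proof (rule insert_spanned_mono)
  show "{b, c} \<subseteq> S" using assms by auto
  show "r (insert a {b, c}) \<le> r {b, c}"
    using assms(1) rank_pair[of b c] by (auto simp: triangle_def)
qed

lemma triad_cospan:
  assumes "triad a b c" "b \<notin> S" "c \<notin> S" "a \<notin> S" "S \<subseteq> E" shows "r (insert a S) = r S + 1"
proof -
  have "S \<subseteq> E - {a, b, c}" using assms by auto
  then have "r (insert a (E - {a, b, c})) + r S \<le> r (insert a S) + r (E - {a, b, c})"
    by (rule insert_marginal_antimono)
  moreover have "insert a (E - {a, b, c}) = E - {b, c}" using assms XE by (auto simp: triad_def)
  moreover have "r (E - {b, c}) = r E" using assms rank_pair[of b c] by (auto simp: triad_def)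
  ultimately show ?thesis using assms(1) rank_insert_le[of a S] by (auto simp: triad_def)
qed

lemma orthogonal:
  assumes "triad a b c" "triangle a d e" shows "d \<in> {b, c} \<or> e \<in> {b, c}"
proof (rule ccontr)
  assume "\<not> ?thesis"
  then have "r (insert a (E - {a, b, c})) = r (E - {a, b, c})"
    using triangleD[OF assms(2)] XE by (intro triangle_span[OF assms(2)]) auto
  moreover have "r (insert a (E - {a, b, c})) = r (E - {a, b, c}) + 1"
    by (rule triad_cospan[OF assms(1)]) auto
  ultimately show False by simp
qed

lemma G_span:
  assumes "C \<in> G" "C' \<subseteq> X - {f}" "r (C \<union> C') \<le> r C" "r (C \<union> C') \<le> r C'"
  shows "C' \<in> G"
proof (rule G_closed[OF assms(1,2)])
  fix Y
  have "r (Y \<union> (C \<union> C')) + r C \<le> r (Y \<union> C) + r (C \<union> C')"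
    "r (Y \<union> (C \<union> C')) + r C' \<le> r (Y \<union> C') + r (C \<union> C')" by (auto intro: marginal_antimono)
  moreover have "r (Y \<union> C) \<le> r (Y \<union> (C \<union> C'))" "r (Y \<union> C') \<le> r (Y \<union> (C \<union> C'))"
    "r C \<le> r (C \<union> C')" "r C' \<le> r (C \<union> C')" by (auto intro: rank_mono)
  ultimately show "r (Y \<union> C') + r C = r (Y \<union> C) + r C'" using assms(3,4) by linarith
qed

text \<open>After contracting $a$, the elements $b$ and $c$ are parallel and hence interchangeable.\<close>

lemma triangle_con_imp_del:
  assumes tri: "triangle a b c" and "a \<noteq> f" "b \<noteq> f" "con a" shows "del b"
proof -
  obtain C where C: "C \<in> G" "a \<in> C" using assms by (auto simp: con_def)
  show ?thesis
  proof (cases "b \<in> C")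
    case True
    have c: "r (insert c C) = r C" using triangle_perms[OF tri] True C by (auto intro: triangle_span)
    \<comment> \<open>\<open>f\<close> is outside the closure of \<open>C\<close>, so the spanned
      element \<open>c\<close> is not \<open>f\<close> and may replace \<open>b\<close> in
      \<open>C\<close>.\<close>
    then have "c \<noteq> f" using G_nonloop[OF C(1)] by auto
    let ?C = "insert c (C - {b})"
    have "r (insert b ?C) = r ?C" using triangle_perms[OF tri] C triangleD[OF tri]
      by (intro triangle_span[of b a c]) auto
    moreover have "C \<union> ?C = insert c C" "insert b ?C = insert c C" using True by auto
    ultimately have "?C \<in> G" using C G_sub[OF C(1)] \<open>c \<noteq> f\<close> triangleD[OF tri] c
      by (intro G_span[OF C(1)]) auto
    then show ?thesis using triangleD[OF tri] unfolding del_def by (intro bexI[of _ ?C]) auto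
  qed (use C in \<open>auto simp: del_def\<close>)
qed

section \<open>Tutte's triangle lemma inside the line\<close>

lemma triad_pairI:
  assumes "del_separation r E X a P" "b \<in> P" "r (P - {b}) + r (E - (P - {b})) \<le> r E + 1"
  shows "\<exists>s. triad a b s \<and> P = {b, s}"
proof -
  have P: "a \<notin> P" "insert a P \<subseteq> X" "2 \<le> card P" "r P + r (E - P - {a}) \<le> r E + 1"
    using assms(1) by (auto simp: del_separation_def)
  have "P - {b} \<noteq> {}" using P(3) by (rule card2_remove_nonempty)
  then obtain s where s: "P - {b} = {s}" using conn_small[of "P - {b}"] assms P by auto
  then have Ps: "P = {b, s}" "s \<noteq> b" using assms by auto
  have "E - P - {a} = E - {a, b, s}" using Ps by auto
  then have "triad a b s" using P Ps rank_pair(1)[of b s] by (auto simp: triad_def)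
  then show ?thesis using Ps by auto
qed

text \<open>Moving \<open>a\<close> to a side that spans it would produce a set inside
  \<open>X\<close> with at least two elements and \<lambda> at most 1.\<close>

lemma del_separation_nospan:
  assumes "del_separation r E X a P" shows "r P < r (insert a P)" "r (E - P - {a}) < r (E - P)"
proof -
  have P: "a \<notin> P" "insert a P \<subseteq> X" "2 \<le> card P" "r P + r (E - P - {a}) \<le> r E + 1"
    using assms(1) by (auto simp: del_separation_def)
  have "r E + 2 \<le> r (insert a P) + r (E - insert a P)" "r E + 2 \<le> r P + r (E - P)"
    using P card2_mono[of P "insert a P"] by (auto intro!: conn2)
  moreover have "E - insert a P = E - P - {a}" by auto
  ultimately show "r P < r (insert a P)" "r (E - P - {a}) < r (E - P)" using P by auto
qed

lemma del_separation_splits: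
  assumes tri: "triangle a b c" and D: "del_separation r E X a P" shows "b \<in> P \<longleftrightarrow> c \<notin> P"
proof -
  have a: "a \<in> E" "a \<notin> P" using triangleD[OF tri] XE D by (auto simp: del_separation_def)
  have "\<not> (b \<in> P \<and> c \<in> P)"
    using triangle_span[OF tri, of P] del_separation_nospan[OF D] by auto
  moreover have "\<not> (b \<notin> P \<and> c \<notin> P)"
  proof
    assume "b \<notin> P \<and> c \<notin> P"
    then have "r (insert a (E - P - {a})) = r (E - P - {a})"
      using triangleD[OF tri] XE by (intro triangle_span[OF tri]) auto
    moreover have "insert a (E - P - {a}) = E - P" using a by auto
    ultimately show False using del_separation_nospan[OF D] by auto
  qed
  ultimately show ?thesis by blast
qed

text \<open>Let \<open>Q\<close> and \<open>S\<close> be the other sides.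
  \<open>P \<union> R\<close> contains \<open>b\<close> and \<open>c\<close> and gains
  \<open>a\<close> for free; \<open>Q \<union> S\<close> contains \<open>a\<close> and
  \<open>c\<close> and gains \<open>b\<close> for free. Uncrossing \<open>P\<close> with
  \<open>R\<close> therefore makes them disjoint. Uncrossing \<open>P\<close> with \<open>S\<close>
  leaves \<lambda>(P - {b}) \<le> 1, so \<open>P\<close> is a pair that forms a triad with
  \<open>a\<close>.\<close>

lemma triangle_lemma_aux:
  assumes tri: "triangle a b c" and D: "del_separation r E X a P" "del_separation r E X b R"
    and bP: "b \<in> P" and cR: "c \<in> R"
  shows "\<exists>s. triad a b s \<and> s \<notin> {a, b, c}"
proof -
  define Q S where "Q = E - P - {a}" and "S = E - R - {b}"
  have P: "a \<notin> P" "insert a P \<subseteq> X" "2 \<le> card P" "r P + r Q \<le> r E + 1"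
    using D(1) by (auto simp: del_separation_def Q_def)
  have R: "b \<notin> R" "insert b R \<subseteq> X" "2 \<le> card R" "r R + r S \<le> r E + 1"
    using D(2) by (auto simp: del_separation_def S_def)
  have cP: "c \<notin> P" and aR: "a \<notin> R"
    using del_separation_splits[OF tri D(1)] del_separation_splits[OF triangle_perms(2)[OF tri] D(2)] bP cR
    by auto
  note tri' = triangle_perms[OF tri] and d = triangleD[OF tri]
  have mem: "c \<in> Q" "a \<in> S" using d XE cP aR by (auto simp: Q_def S_def)
  have "r (P \<union> R) + r (P \<inter> R) \<le> r P + r R" "r (Q \<union> S) + r (Q \<inter> S) \<le> r Q + r S"
    by (rule rank_submod)+
  moreover have "r (E - (P \<inter> R)) \<le> r (insert b (Q \<union> S))" by (rule rank_mono) (use mem in \<open>auto simp: Q_def S_def\<close>)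
  moreover have "r (insert b (Q \<union> S)) = r (Q \<union> S)" by (rule triangle_span[OF tri'(2)]) (use mem in auto)
  moreover have "r (insert a (P \<union> R)) = r (P \<union> R)" by (rule triangle_span[OF tri]) (use bP cR in auto)
  moreover have "r (E - insert a (P \<union> R)) \<le> r (Q \<inter> S)" by (rule rank_mono) (use bP in \<open>auto simp: Q_def S_def\<close>)
  moreover have "r E + 2 \<le> r (insert a (P \<union> R)) + r (E - insert a (P \<union> R))"
    using P R by (intro conn2 card2_mono[OF P(3)]) auto
  ultimately have "r (P \<inter> R) + r (E - (P \<inter> R)) \<le> r E" using P R by linarith
  then have PR: "P \<inter> R = {}" using conn_nonempty[of "P \<inter> R"] P by auto
  then have eqs: "P \<inter> S = P - {b}" "Q \<inter> R = R" using P R aR XE by (auto simp: Q_def S_def)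
  have "r (P \<union> S) + r (P - {b}) \<le> r P + r S" "r (Q \<union> R) + r R \<le> r Q + r R"
    using rank_submod[of P S] rank_submod[of Q R] eqs by auto
  moreover have "r (E - (P - {b})) \<le> r (insert b (insert a (Q \<union> R)))"
    by (rule rank_mono) (use eqs in \<open>auto simp: Q_def S_def\<close>)
  moreover have "r (insert b (insert a (Q \<union> R))) = r (insert a (Q \<union> R))"
    by (rule triangle_span[OF tri'(2)]) (use mem in auto)
  moreover have "r (insert a (Q \<union> R)) \<le> r (Q \<union> R) + 1" by (rule rank_insert_le)
  moreover have "r (E - R) \<le> r (P \<union> S)" by (rule rank_mono) (use bP in \<open>auto simp: Q_def S_def\<close>)
  moreover have "r E + 2 \<le> r R + r (E - R)" using R by (intro conn2) auto
  ultimately have "r (P - {b}) + r (E - (P - {b})) \<le> r E + 1" using P R by linarith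
  then obtain s where s: "triad a b s" "P = {b, s}" using triad_pairI[OF D(1) bP] by auto
  then have "s \<notin> {a, b, c}" using triadD[OF s(1)] cP by auto
  then show ?thesis using s by auto
qed

text \<open>Tutte's triangle lemma, for separations inside $X$.\<close>

lemma triangle_lemma:
  assumes tri: "triangle a b c" and D: "del_separation r E X a P" "del_separation r E X b R"
  shows "\<exists>u y. (u = b \<or> u = c) \<and> triad a u y \<and> y \<notin> {a, b, c}"
proof -
  define Q S where "Q = E - P - {a}" and "S = E - R - {b}"
  have P: "a \<notin> P" "insert a P \<subseteq> X" "2 \<le> card P" "r P + r Q \<le> r E + 1"
    using D(1) by (auto simp: del_separation_def Q_def)
  have R: "b \<notin> R" "insert b R \<subseteq> X" "2 \<le> card R" "r R + r S \<le> r E + 1"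
    using D(2) by (auto simp: del_separation_def S_def)
  note tri' = triangle_perms[OF tri] and d = triangleD[OF tri]
  have split: "b \<in> P \<longleftrightarrow> c \<notin> P" "a \<in> R \<longleftrightarrow> c \<notin> R"
    using del_separation_splits[OF tri D(1)] del_separation_splits[OF tri'(2) D(2)] by auto
  have sm: "r (P \<union> R) + r (P \<inter> R) \<le> r P + r R" "r (Q \<union> S) + r (Q \<inter> S) \<le> r Q + r S"
    "r (P \<union> S) + r (P \<inter> S) \<le> r P + r S" "r (Q \<union> R) + r (Q \<inter> R) \<le> r Q + r R"
    by (rule rank_submod)+
  \<comment> \<open>Each separation splits the other two elements of the triangle, which leaves four
    patterns; the second is the first with \<open>a\<close> and \<open>b\<close> exchanged.\<close>
  consider "b \<in> P" "c \<in> R" | "c \<in> P" "a \<in> R" | "b \<in> P" "a \<in> R" "c \<notin> P" "c \<notin> R"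
    | "c \<in> P" "c \<in> R" "b \<notin> P" "a \<notin> R" using split by blast
  then show ?thesis
  proof cases
    case 1
    then show ?thesis using triangle_lemma_aux[OF tri D] by blast
  next
    case 2
    then obtain s where s: "triad b a s" "s \<notin> {b, a, c}"
      using triangle_lemma_aux[OF tri'(2) D(2,1)] by auto
    then show ?thesis using triad_perms(2)[OF s(1)] by auto
  next
    case 3
    have mem: "c \<in> Q" "c \<in> S" using d XE 3 by (auto simp: Q_def S_def)
    have a1: "r (insert c (P \<union> R)) = r (P \<union> R)" by (rule triangle_span[OF tri'(4)]) (use 3 in auto)
    have a2: "r (E - insert c (P \<union> R)) \<le> r (Q \<inter> S)" by (rule rank_mono) (use 3 in \<open>auto simp: Q_def S_def\<close>)
    have a3: "r E + 2 \<le> r (insert c (P \<union> R)) + r (E - insert c (P \<union> R))"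
      using P R d by (intro conn2 card2_mono[OF P(3)]) auto
    have "r (E - (P \<inter> R)) \<le> r (insert b (insert a (Q \<union> S)))"
      by (rule rank_mono) (auto simp: Q_def S_def)
    moreover have "r (insert b (insert a (Q \<union> S))) = r (insert a (Q \<union> S))"
      by (rule triangle_span[OF tri'(2)]) (use mem in auto)
    moreover have "r (insert a (Q \<union> S)) \<le> r (Q \<union> S) + 1" by (rule rank_insert_le)
    ultimately have "r (P \<inter> R) + r (E - (P \<inter> R)) \<le> r E + 1" using P R sm a1 a2 a3 by linarith
    then consider "P \<inter> R = {}" | t where "P \<inter> R = {t}" using conn_small[of "P \<inter> R"] P by blast
    then show ?thesis
    proof cases
      case (2 t)
      then have t: "t \<in> P" "t \<in> R" "t \<in> X" using P by auto
      have "r (Q \<union> S) \<le> r E - 1" using P R sm a1 a2 a3 2 rank_singleton[OF t(3)] by simp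
      moreover have "r (E - {a, b, t}) \<le> r (Q \<union> S)" by (rule rank_mono) (use 2 in \<open>auto simp: Q_def S_def\<close>)
      moreover have "t \<noteq> a" "t \<noteq> b" "t \<noteq> c" using t 3 P R by auto
      ultimately have "triad a b t" using d t by (auto simp: triad_def)
      then show ?thesis using \<open>t \<noteq> a\<close> \<open>t \<noteq> b\<close> \<open>t \<noteq> c\<close> by blast
    next
      case 1
      then have eqs: "P \<inter> S = P - {b}" "Q \<inter> R = R - {a}" using P R XE by (auto simp: Q_def S_def)
      have "r (E - (P \<inter> S)) \<le> r (insert b (Q \<union> R))" by (rule rank_mono) (use 3 in \<open>auto simp: Q_def S_def\<close>)
      moreover have "r (insert b (Q \<union> R)) = r (Q \<union> R)" by (rule triangle_span[OF tri'(2)]) (use mem 3 in auto)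
      moreover have "r (E - (Q \<inter> R)) \<le> r (insert a (P \<union> S))" by (rule rank_mono) (use 3 in \<open>auto simp: Q_def S_def\<close>)
      moreover have "r (insert a (P \<union> S)) = r (P \<union> S)" by (rule triangle_span[OF tri]) (use mem 3 in auto)
      moreover have "r E + 1 \<le> r (Q \<inter> R) + r (E - (Q \<inter> R))"
      proof (rule conn_nonempty)
        show "Q \<inter> R \<noteq> {}" unfolding eqs using R(3) by (rule card2_remove_nonempty)
      qed (use R in auto)
      ultimately have "r (P - {b}) + r (E - (P - {b})) \<le> r E + 1" using P R sm eqs by auto
      then obtain s where s: "triad a b s" "P = {b, s}" using triad_pairI[OF D(1)] 3 by auto
      then have "s \<notin> {a, b, c}" using triadD[OF s(1)] 3 by auto
      then show ?thesis using s by auto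
    qed
  next
    case 4
    have mem: "b \<in> Q" "a \<in> S" using d XE 4 by (auto simp: Q_def S_def)
    let ?U = "insert b (insert a (P \<union> R))"
    have "r ?U = r (insert a (P \<union> R))" by (rule triangle_span[OF tri'(2)]) (use 4 in auto)
    moreover have "r (insert a (P \<union> R)) \<le> r (P \<union> R) + 1" by (rule rank_insert_le)
    moreover have "r (E - ?U) \<le> r (Q \<inter> S)" by (rule rank_mono) (auto simp: Q_def S_def)
    moreover have "r E + 2 \<le> r ?U + r (E - ?U)" using P R d by (intro conn2 card2_mono[OF P(3)]) auto
    moreover have "r (E - (P \<inter> R)) \<le> r (Q \<union> S)" by (rule rank_mono) (use mem in \<open>auto simp: Q_def S_def\<close>)
    ultimately have "r (P \<inter> R) + r (E - (P \<inter> R)) \<le> r E + 1" using P R sm by linarith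
    then have "P \<inter> R = {} \<or> (\<exists>t. P \<inter> R = {t})" using conn_small[of "P \<inter> R"] P by auto
    moreover have "c \<in> P \<inter> R" using 4 by simp
    ultimately have PR: "P \<inter> R = {c}" by (metis empty_iff singletonD)
    then have eqs: "P \<inter> S = P - {c}" "Q \<inter> R = R - {c}" using P R 4 XE by (auto simp: Q_def S_def)
    have "r (E - (P \<inter> S)) \<le> r (insert a (Q \<union> R))" by (rule rank_mono) (use mem in \<open>auto simp: Q_def S_def\<close>)
    moreover have "r (insert a (Q \<union> R)) = r (Q \<union> R)" by (rule triangle_span[OF tri]) (use mem 4 in auto)
    moreover have "r (E - (Q \<inter> R)) \<le> r (insert b (P \<union> S))" by (rule rank_mono) (use mem in \<open>auto simp: Q_def S_def\<close>)
    moreover have "r (insert b (P \<union> S)) = r (P \<union> S)" by (rule triangle_span[OF tri'(2)]) (use mem 4 in auto)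
    moreover have "r E + 1 \<le> r (Q \<inter> R) + r (E - (Q \<inter> R))"
    proof (rule conn_nonempty)
      show "Q \<inter> R \<noteq> {}" unfolding eqs using R(3) by (rule card2_remove_nonempty)
    qed (use R in auto)
    ultimately have "r (P - {c}) + r (E - (P - {c})) \<le> r E + 1" using P R sm eqs by auto
    then obtain s where s: "triad a c s" "P = {c, s}" using triad_pairI[OF D(1)] 4 by auto
    then have "s \<notin> {a, b, c}" using triadD[OF s(1)] 4 by auto
    then show ?thesis using s by auto
  qed
qed

end

section \<open>Fans\<close>

context obstruction
begin

interpretation d: obstruction "dual E" E X f "(\<lambda>C. X - {f} - C) ` G" by (rule dual_obstruction)

lemma triad_del_imp_con:
  assumes "triad a b c" "a \<noteq> f" "b \<noteq> f" "del a" shows "con b"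
  using d.triangle_con_imp_del[of a b c] triadD[OF assms(1)] assms
  by (simp add: dual_triangle dual_con dual_del)

lemma triangle_del_separation:
  assumes "triangle a b c" "a \<noteq> f" "del a" shows "\<exists>P. del_separation r E X a P"
proof -
  have a: "a \<in> X - {f}" "insert a (X - {a}) = X" using triangleD[OF assms(1)] assms by auto
  have "r (insert a (X - {a})) = r (X - {a})"
    using triangleD[OF assms(1)] by (intro triangle_span[OF assms(1)]) auto
  then show ?thesis using del_sep a assms(3) by (auto simp: del_def)
qed

text \<open>The triangle lemma applies to \<open>x1\<close>, whose deletion has a separation by
  \<open>del x1\<close>, and to \<open>x2\<close>, whose deletion is separated by
  \<open>{x3, x4}\<close> because of the triad. The third element \<open>y\<close> of the resulting
  triad is new: inside \<open>F\<close>, it would make \<open>x1\<close> both spanned and cospanned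
  by the rest of \<open>F\<close>, and \<lambda>(F) would drop to 1.\<close>

lemma fan_step:
  assumes tri: "triangle x1 x2 x3" and trd: "triad x2 x3 x4" and x1: "x1 \<noteq> f" "del x1"
    and F: "{x1, x2, x3, x4} \<subseteq> F" "F \<subseteq> X" "r (F - {x1}) + r (E - (F - {x1})) \<le> r E + 2"
  shows "\<exists>y u v. (u = x2 \<and> v = x3 \<or> u = x3 \<and> v = x2) \<and> triad y x1 u \<and> triangle x1 u v \<and> y \<notin> F
    \<and> r F + r (E - F) \<le> r E + 2"
proof -
  note d = triangleD[OF tri] triadD[OF trd]
  obtain P where P: "del_separation r E X x1 P" using triangle_del_separation[OF tri x1] by auto
  have "E - {x3, x4} - {x2} = E - {x2, x3, x4}" by auto
  then have P2: "del_separation r E X x2 {x3, x4}"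
    using trd rank_pair(1)[of x3 x4] by (auto simp: del_separation_def triad_def)
  obtain u y where u: "u = x2 \<or> u = x3" "triad x1 u y" "y \<notin> {x1, x2, x3}"
    using triangle_lemma[OF tri P P2] by blast
  have xF: "insert x1 (F - {x1}) = F" "x1 \<in> F" using F by auto
  have "r (insert x1 (F - {x1})) = r (F - {x1})" by (rule triangle_span[OF tri]) (use F d in auto)
  then have rF: "r F = r (F - {x1})" using xF by simp
  have co: "E - (F - {x1}) = insert x1 (E - F)" using xF F XE by auto
  have "y \<notin> F"
  proof
    assume "y \<in> F"
    have "r (insert x1 (E - F)) = r (E - F) + 1"
      by (rule triad_cospan[OF u(2)]) (use \<open>y \<in> F\<close> u F in auto)
    then have "r F + r (E - F) \<le> r E + 1" using rF co F(3) by simp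
    moreover have "2 \<le> card F" by (rule card2_mono[of "{x1, x2}"]) (use d F in auto)
    ultimately show False using conn2[OF F(2)] by simp
  qed
  moreover have "r F + r (E - F) \<le> r E + 2"
    using rF co F(3) rank_mono[OF subset_insertI, of "E - F" x1] by simp
  moreover have "triad y x1 u" using triad_perms(4)[OF u(2)] .
  ultimately show ?thesis using u(1) tri triangle_perms(1)[OF tri] by blast
qed

text \<open>Going round the fan: if \<open>x1\<close> could not be deleted, it could be contracted,
  so \<open>x3\<close> could be deleted, \<open>x2\<close> contracted, and \<open>x1\<close> deleted
  after all.\<close>

lemma fan_end_del:
  assumes tri: "triangle x1 x2 x3" and trd: "triad x2 x3 x4" and f: "f \<notin> {x1, x2, x3}"
  shows "del x1"
proof (rule ccontr)
  assume n: "\<not> del x1"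
  then have "con x1" using del_or_con by blast
  then have "del x3" using triangle_con_imp_del[OF triangle_perms(1)[OF tri]] f by auto
  then have "con x2" using triad_del_imp_con[OF triad_perms(2)[OF trd]] f by auto
  then show False using triangle_con_imp_del[OF triangle_perms(2)[OF tri]] f n by auto
qed

end

text \<open>Each step adds an element \<open>y\<close> beyond the current end and passes to the
  dual, where \<open>y\<close>, \<open>x1\<close>, \<open>u\<close>, \<open>v\<close> is again a fan
  that starts with a triangle. The set \<open>F\<close> grows within the finite set
  \<open>X\<close>, and as it contains \<open>f\<close>, the new element is never
  \<open>f\<close>.\<close>

lemma no_fan_containing_f:
  assumes "obstruction r E X f G" "obstruction.triangle r X x1 x2 x3" "obstruction.triad r E X x2 x3 x4"
    "{x1, x2, x3, x4} \<subseteq> F" "F \<subseteq> X" "r (F - {x1}) + r (E - (F - {x1})) \<le> r E + 2"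
    "f \<notin> {x1, x2, x3}" "f \<in> F"
  shows False
  using assms
proof (induction "card (X - F)" arbitrary: r G x1 x2 x3 x4 F rule: less_induct)
  case less
  interpret obstruction r E X f G by fact
  obtain y u v where y: "u = x2 \<and> v = x3 \<or> u = x3 \<and> v = x2" "triad y x1 u" "triangle x1 u v"
    "y \<notin> F" "r F + r (E - F) \<le> r E + 2"
    using fan_step[OF less.prems(2,3) _ fan_end_del[OF less.prems(2,3,7)] less.prems(4,5,6)]
      less.prems(7) by auto
  have yX: "y \<in> X" using triadD[OF y(2)] by auto
  have "card (X - insert y F) < card (X - F)" using yX y(4) finX by (intro psubset_card_mono) auto
  moreover have "insert y F - {y} = F" using y(4) by auto
  then have "dual E (insert y F - {y}) + dual E (E - (insert y F - {y})) \<le> dual E E + 2"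
    using dual_lambda[OF finE, of F] y(5) less.prems(5) XE by force
  moreover have "obstruction.triangle (dual E) X y x1 u" "obstruction.triad (dual E) E X x1 u v"
    using y by (simp_all add: dual_triangle dual_triad)
  ultimately show False using y less.prems yX
    by (intro less.hyps[of "insert y F" "dual E" "(\<lambda>C. X - {f} - C) ` G" y x1 u v] dual_obstruction) auto
qed

lemma no_fan_end_aux:
  assumes "obstruction r E X f G" "obstruction.triangle r X x1 x2 x3" "obstruction.triad r E X x2 x3 x4"
    "{x1, x2, x3, x4} \<subseteq> F" "F \<subseteq> X" "r (F - {x1}) + r (E - (F - {x1})) \<le> r E + 2"
    "f \<notin> {x1, x2, x3}"
  shows False
  using assms
proof (induction "card (X - F)" arbitrary: r G x1 x2 x3 x4 F rule: less_induct)
  case less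
  interpret obstruction r E X f G by fact
  obtain y u v where y: "u = x2 \<and> v = x3 \<or> u = x3 \<and> v = x2" "triad y x1 u" "triangle x1 u v"
    "y \<notin> F" "r F + r (E - F) \<le> r E + 2"
    using fan_step[OF less.prems(2,3) _ fan_end_del[OF less.prems(2,3,7)] less.prems(4,5,6)]
      less.prems(7) by auto
  have yX: "y \<in> X" using triadD[OF y(2)] by auto
  show False
  proof (cases "y = f")
    case True
    \<comment> \<open>The growth has reached \<open>f\<close>. Read backwards, the fan
      \<open>v\<close>, \<open>u\<close>, \<open>x1\<close>, \<open>f\<close> grows from
      \<open>v\<close> instead, and its four elements already form a set containing
      \<open>f\<close>.\<close>
    let ?F = "{v, u, x1, f}"
    have t: "triangle v u x1" "triad u x1 f" using triangle_perms(5)[OF y(3)] triad_perms(5)[OF y(2)] True by auto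
    have "f \<noteq> v" using y(4) less.prems(4) True y(1) by auto
    then have e: "?F - {v} = {u, x1, f}" using triangleD[OF t(1)] by auto
    have "r {u, x1, f} \<le> 3" using rank_le_card[of "{u, x1, f}"] triadD[OF t(2)] by simp
    then have "r (?F - {v}) + r (E - (?F - {v})) \<le> r E + 2" unfolding e using t(2) by (simp add: triad_def)
    moreover have "f \<notin> {v, u, x1}" "?F \<subseteq> X"
      using triadD[OF t(2)] triangleD[OF t(1)] \<open>f \<noteq> v\<close> by auto
    ultimately show False using no_fan_containing_f[OF less.prems(1) t, of ?F] by blast
  next
    case False
    have "card (X - insert y F) < card (X - F)" using yX y(4) finX by (intro psubset_card_mono) auto
    moreover have "insert y F - {y} = F" using y(4) by auto
    then have "dual E (insert y F - {y}) + dual E (E - (insert y F - {y})) \<le> dual E E + 2"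
      using dual_lambda[OF finE, of F] y(5) less.prems(5) XE by force
    moreover have "obstruction.triangle (dual E) X y x1 u" "obstruction.triad (dual E) E X x1 u v"
      using y by (simp_all add: dual_triangle dual_triad)
    ultimately show False using y less.prems yX False
      by (intro less.hyps[of "insert y F" "dual E" "(\<lambda>C. X - {f} - C) ` G" y x1 u v] dual_obstruction) auto
  qed
qed

section \<open>Exclusion of four-element fans\<close>

context obstruction
begin

interpretation d: obstruction "dual E" E X f "(\<lambda>C. X - {f} - C) ` G" by (rule dual_obstruction)

lemma triangle_not_triad: assumes "triangle a b c" shows "\<not> triad a b c"
proof
  assume "triad a b c"
  then have "r {a, b, c} + r (E - {a, b, c}) \<le> r E + 1" using assms by (auto simp: triangle_def triad_def)
  then show False using conn2[of "{a, b, c}"] assms by (auto simp: triangle_def)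
qed

lemma no_fan_end:
  assumes tri: "triangle x1 x2 x3" and trd: "triad x2 x3 x4" and f: "f \<notin> {x1, x2, x3}"
  shows False
proof -
  note d = triangleD[OF tri] triadD[OF trd]
  have "x1 \<noteq> x4" using triangle_not_triad[OF tri] triad_perms(4)[OF trd] by auto
  then have e: "{x1, x2, x3, x4} - {x1} = {x2, x3, x4}" using d by auto
  have "r {x2, x3, x4} \<le> 3" using rank_le_card[of "{x2, x3, x4}"] d by simp
  then show False
    using no_fan_end_aux[OF obstruction_axioms tri trd, of "{x1, x2, x3, x4}"] d f trd unfolding e
    by (auto simp: triad_def)
qed

text \<open>The fan can be extended twice beyond \<open>x4\<close>: the dual step gives
  \<open>z\<close>, and \<open>del z\<close> then gives \<open>w\<close>. Fans without
  \<open>f\<close> among the first three elements are already excluded, so both extensions use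
  \<open>f\<close>. But then the triad \<open>w\<close>, \<open>z\<close>, \<open>f\<close> meets
  the triangle \<open>x1\<close>, \<open>x2\<close>, \<open>f\<close> in \<open>f\<close>
  alone.\<close>

lemma no_fan_f_inner_con:
  assumes tri: "triangle x1 x2 f" and trd: "triad x2 f x4" and con: "con x4"
  shows False
proof -
  note d = triangleD[OF tri] triadD[OF trd]
  let ?F = "{x4, f, x2, x1}"
  have "x1 \<noteq> x4" using triangle_not_triad[OF tri] triad_perms(4)[OF trd] by auto
  then have e: "?F - {x4} = {x1, x2, f}" using d by auto
  have "r {x1, x2, f} + r (E - {x1, x2, f}) \<le> r E + 2"
    using tri rank_mono[of "E - {x1, x2, f}" E] by (auto simp: triangle_def)
  then have lam: "dual E (?F - {x4}) + dual E (E - (?F - {x4})) \<le> dual E E + 2"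
    unfolding e using dual_lambda[OF finE, of "{x1, x2, f}"] d XE by (simp add: subset_iff)
  have "x4 \<noteq> f" using d by auto
  then have "\<exists>z u v. (u = f \<and> v = x2 \<or> u = x2 \<and> v = f) \<and> triangle z x4 u \<and> triad x4 u v \<and> z \<notin> ?F
      \<and> dual E ?F + dual E (E - ?F) \<le> dual E E + 2"
    using d.fan_step[of x4 f x2 x1 ?F] triad_perms(5)[OF trd] triangle_perms(5)[OF tri] d con lam
    unfolding dual_triangle dual_triad by (simp add: dual_del)
  then obtain z u v where z: "u = f \<and> v = x2 \<or> u = x2 \<and> v = f" "triangle z x4 u" "triad x4 u v"
    "z \<notin> ?F" "dual E ?F + dual E (E - ?F) \<le> dual E E + 2" by auto
  have "u \<noteq> x2"
  proof
    assume "u = x2"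
    then have "triangle z x4 x2" "triad x4 x2 f" using z by auto
    then show False using no_fan_end[of z x4 x2 f] z(4) d by auto
  qed
  then have z2: "triangle z x4 f" "triad x4 f x2" using z by auto
  have "del z" using triangle_con_imp_del[OF triangle_perms(2)[OF z2(1)]] con d z(4) by auto
  have FX: "?F \<subseteq> X" "?F \<subseteq> E" using d XE by auto
  have "insert z ?F - {z} = ?F" using z(4) by auto
  moreover have "r ?F + r (E - ?F) \<le> r E + 2" using dual_lambda[OF finE FX(2)] z(5) by linarith
  moreover have "insert z ?F \<subseteq> X" "z \<noteq> f" using FX triangleD[OF z2(1)] by auto
  ultimately obtain w u' v' where w: "u' = x4 \<and> v' = f \<or> u' = f \<and> v' = x4" "triad w z u'"
    "triangle z u' v'" "w \<notin> insert z ?F"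
    using fan_step[OF z2 _ \<open>del z\<close>, of "insert z ?F"] by auto
  show False
  proof (cases "u' = x4")
    case True
    then have "triad w z x4" using w by auto
    then show False using obstruction.no_fan_end[OF dual_obstruction, of w z x4 f] z2 w(4) z(4) d
      unfolding dual_triangle dual_triad by auto
  next
    case False
    then have "triad w z f" using w by auto
    then show False using orthogonal[OF triad_perms(4) triangle_perms(4)[OF tri], of w z] w(4) z(4) by auto
  qed
qed

text \<open>By the previous case \<open>x4\<close> cannot be contracted, so the exchange rules make
  \<open>x1\<close> deletable. That is the dual of the excluded case, since the fan read backwards
  has the same shape.\<close>

lemma no_fan_f_third:
  assumes tri: "triangle x1 x2 f" and trd: "triad x2 f x4" shows False
proof -
  note d = triangleD[OF tri] triadD[OF trd]
  have "\<not> con x4" using no_fan_f_inner_con[OF tri trd] by blast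
  then have "\<not> del x2" using triad_del_imp_con[OF triad_perms(1)[OF trd]] d by auto
  then have "\<not> con x1" using triangle_con_imp_del[OF tri] d by auto
  then have "d.con x1" using del_or_con d dual_con by blast
  then show False
    using obstruction.no_fan_f_inner_con[OF dual_obstruction, of x4 x2 x1] triad_perms(4)[OF trd] triangle_perms(3)[OF tri]
    unfolding dual_triangle dual_triad by blast
qed

lemma no_fan:
  assumes tri: "triangle x1 x2 x3" and trd: "triad x2 x3 x4" shows False
proof -
  note d = triangleD[OF tri] triadD[OF trd]
  have "f \<in> {x1, x2, x3}" using no_fan_end[OF tri trd] by blast
  moreover have "f \<in> {x4, x3, x2}"
    using obstruction.no_fan_end[OF dual_obstruction, of x4 x3 x2 x1] triad_perms(5)[OF trd] triangle_perms(5)[OF tri]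
    unfolding dual_triangle dual_triad by blast
  moreover have "x1 \<noteq> x4" using triangle_not_triad[OF tri] triad_perms(4)[OF trd] by auto
  ultimately have "f = x2 \<or> f = x3" by auto
  then show False
    using no_fan_f_third[of x1 x2 x4] no_fan_f_third[of x1 x3 x4] tri trd
      triangle_perms(1)[OF tri] triad_perms(2)[OF trd] by auto
qed

lemma triangle_triad_no_common_pair: "triangle a b c \<Longrightarrow> \<not> triad a b d"
  using no_fan[of c a b d] triangle_perms(4) by blast

lemma triangle_not_two_separations:
  assumes "triangle a b c" "del_separation r E X a P" shows "\<not> del_separation r E X b R"
proof
  assume "del_separation r E X b R"
  then obtain u y where u: "u = b \<or> u = c" "triad a u y" using triangle_lemma[OF assms] by blast
  then show False using triangle_triad_no_common_pair[OF assms(1), of y]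
      triangle_triad_no_common_pair[OF triangle_perms(1)[OF assms(1)], of y] by auto
qed

lemma triangle_not_both_del:
  assumes "triangle a b c" "a \<noteq> f" "b \<noteq> f" "del a" shows "\<not> del b"
  using triangle_del_separation[OF assms(1,2,4)] triangle_del_separation[OF triangle_perms(2)[OF assms(1)] assms(3)]
    triangle_not_two_separations[OF assms(1)] by blast

text \<open>Of two elements of a triangle that avoids \<open>f\<close>, at most one can be deleted.
  So two of the three can only be contracted, and contracting one of them allows deleting the
  other.\<close>

lemma triangle_has_f:
  assumes "triangle a b c" shows "f \<in> {a, b, c}"
proof (rule ccontr)
  assume f: "f \<notin> {a, b, c}"
  note p = triangle_perms[OF assms]
  have "\<not> del a \<or> \<not> del b" "\<not> del a \<or> \<not> del c" "\<not> del b \<or> \<not> del c"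
    using triangle_not_both_del[OF assms] triangle_not_both_del[OF p(1)] triangle_not_both_del[OF p(3)] f by auto
  then show False
    using triangle_con_imp_del[OF assms] triangle_con_imp_del[OF p(1)] triangle_con_imp_del[OF p(2)]
      triangle_con_imp_del[OF p(3)] f del_or_con[of a] del_or_con[of b] del_or_con[of c] by auto
qed

lemma triad_has_f: "triad a b c \<Longrightarrow> f \<in> {a, b, c}"
  using obstruction.triangle_has_f[OF dual_obstruction, of a b c] unfolding dual_triangle .

section \<open>Elements that can be both deleted and contracted\<close>

lemma conn_small_card:
  assumes "Y \<subseteq> X" "r Y + r (E - Y) \<le> r E + 1" shows "card Y \<le> 1"
  using conn2[OF assms(1)] assms(2) by linarith

text \<open>The uncrossing argument of Bixby's lemma.\<close>

lemma del_con_separation_triple: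
  assumes D: "del_separation r E X h P" and C: "con_separation r E X h P'"
  shows "\<exists>u v. triangle h u v \<or> triad h u v"
proof -
  have P: "h \<notin> P" "insert h P \<subseteq> X" "2 \<le> card P" "r P + r (E - P - {h}) \<le> r E + 1"
    using D by (auto simp: del_separation_def)
  have P': "h \<notin> P'" "insert h P' \<subseteq> X" "2 \<le> card P'" "r (insert h P') + r (E - P') \<le> r E + 2"
    using C by (auto simp: con_separation_def)
  have fin: "finite P" "finite P'" using P P' rev_finite_subset[OF finX] by auto
  let ?U = "P \<union> insert h P'"
  have "r ?U + r (P \<inter> P') \<le> r P + r (insert h P')" by (rule submod_le) auto
  moreover have "r (E - (P \<inter> P')) + r (E - ?U) \<le> r (E - P - {h}) + r (E - P')"
    by (rule submod_le) (use P P' in auto)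
  moreover have "r E + 2 \<le> r ?U + r (E - ?U)" using P P' by (intro conn2 card2_mono[OF P(3)]) auto
  ultimately have "r (P \<inter> P') + r (E - (P \<inter> P')) \<le> r E + 1" using P P' by linarith
  then have c0: "card (P \<inter> P') \<le> 1" using P by (intro conn_small_card) auto
  \<comment> \<open>Uncrossing \<open>P\<close> with the complement of \<open>P'\<close> bounds a
    total by \<open>2 * r E + 3\<close>, so one of the two differences has \<lambda> at most 1. With
    the small intersection this leaves a side of exactly two elements.\<close>
  have "r (E - (P' - P)) + r (P - P') \<le> r P + r (E - P')"
    by (rule submod_le) (use P P' XE in auto)
  moreover have "r (E - (P - P')) + r (P' - P) \<le> r (E - P - {h}) + r (insert h P')"
    by (rule submod_le) (use P P' XE in auto)
  ultimately have "r (P - P') + r (E - (P - P')) \<le> r E + 1 \<or> r (P' - P) + r (E - (P' - P)) \<le> r E + 1"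
    using P P' by linarith
  then have "card (P - P') \<le> 1 \<or> card (P' - P) \<le> 1"
    using conn_small_card[of "P - P'"] conn_small_card[of "P' - P"] P P' by blast
  moreover have e: "(P \<inter> P') \<union> (P - P') = P" "(P \<inter> P') \<union> (P' - P) = P'" by auto
  have "card P \<le> card (P \<inter> P') + card (P - P')" "card P' \<le> card (P \<inter> P') + card (P' - P)"
    using card_Un_le[of "P \<inter> P'" "P - P'"] card_Un_le[of "P \<inter> P'" "P' - P"]
    unfolding e by auto
  ultimately have "card P = 2 \<or> card P' = 2" using c0 P P' by linarith
  then show ?thesis
  proof
    assume "card P = 2"
    then obtain u v where uv: "P = {u, v}" "u \<noteq> v" by (auto simp: card_2_iff)
    then have "E - P - {h} = E - {h, u, v}" by auto
    then have "triad h u v" using P uv rank_pair(1)[of u v] by (auto simp: triad_def)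
    then show ?thesis by blast
  next
    assume "card P' = 2"
    then obtain u v where uv: "P' = {u, v}" "u \<noteq> v" by (auto simp: card_2_iff)
    then have "triangle h u v" using P' uv rank_pair(2)[of u v] by (auto simp: triangle_def)
    then show ?thesis by blast
  qed
qed

text \<open>If \<open>E - X\<close> spanned \<open>h\<close>, then \<open>X - {h}\<close> would span
  it too, as otherwise \<lambda>(X - {h}) < 2. So the deletion of \<open>h\<close> has a separation
  with a side in \<open>X\<close>; its other side contains \<open>E - X\<close> and spans
  \<open>h\<close>, which is impossible.\<close>

lemma del_not_guts:
  assumes h: "h \<in> X" "h \<noteq> f" "del h" shows "r (insert h (E - X)) = r (E - X) + 1"
proof (rule ccontr)
  assume "\<not> ?thesis"
  then have g: "r (insert h (E - X)) \<le> r (E - X)" using rank_insert_le[of h "E - X"] by linarith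
  have "card (X - {h}) = card X - 1" using h by simp
  then have "r E + 2 \<le> r (X - {h}) + r (E - (X - {h}))" using cardX by (intro conn2) auto
  moreover have "E - (X - {h}) = insert h (E - X)" using h XE by auto
  moreover have "r (X - {h}) \<le> r X" by (rule rank_mono) auto
  ultimately have "r (X - {h}) = r X" using connX g by simp
  then obtain P where P: "del_separation r E X h P" using del_sep h by (auto simp: del_def)
  then have P': "h \<notin> P" "insert h P \<subseteq> X" by (auto simp: del_separation_def)
  have "r (insert h (E - P - {h})) = r (E - P - {h})"
    by (rule insert_spanned_mono[OF _ g]) (use P' h in auto)
  moreover have "insert h (E - P - {h}) = E - P" using P' XE by auto
  ultimately show False using del_separation_nospan(2)[OF P] by simp
qed

lemma con_not_coguts:
  assumes h: "h \<in> X" "h \<noteq> f" "con h" shows "r (X - {h}) = r X"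
proof -
  have "dual E (insert h (E - X)) = dual E (E - X) + 1"
    using obstruction.del_not_guts[OF dual_obstruction, of h] h by (simp add: dual_del)
  moreover have s: "insert h (E - X) = E - (X - {h})" "X - {h} \<subseteq> E" using h XE by auto
  ultimately show ?thesis using h card_Suc_Diff1[of X h] finX
    unfolding s(1) dual_compl_eq[OF finE s(2)] dual_compl_eq[OF finE XE] by simp
qed

lemma del_separation_exists:
  "h \<in> X \<Longrightarrow> h \<noteq> f \<Longrightarrow> del h \<Longrightarrow> r (X - {h}) = r X \<Longrightarrow> \<exists>P. del_separation r E X h P"
  using del_sep by (auto simp: del_def)

lemma del_con_triple:
  assumes h: "h \<in> X" "h \<noteq> f" "del h" "con h" shows "\<exists>u v. triangle h u v \<or> triad h u v"
proof -
  obtain P where "del_separation r E X h P"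
    using del_separation_exists con_not_coguts h by blast
  moreover obtain P' where "con_separation r E X h P'"
    using con_sep[OF _ _ del_not_guts[OF h(1-3)]] h(4) by (auto simp: con_def)
  ultimately show ?thesis by (rule del_con_separation_triple)
qed

end

section \<open>Separations and the position of f\<close>

context obstruction
begin

text \<open>The deletion of \<open>g\<close> is a 2-sum along the separation. If \<open>f\<close>
  remains from \<open>P\<close> as a non-loop spanned by the other side, it takes the place of the
  basepoint, whichever set inside \<open>P\<close> is contracted; hence all such sets give the same
  minor. The fact \<open>eff\<close> expresses this by rank formulas that depend on the contracted
  set only through its rank.\<close>

lemma separation_containing_f_replace:
  assumes D: "del_separation r E X g P" and fP: "f \<in> P" and C: "C \<in> G" "g \<notin> C"
    and C': "C' \<subseteq> P - {f}" "r (insert f C') = r C' + 1"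
      "r (insert f ((E - P - {g}) \<union> C')) = r ((E - P - {g}) \<union> C')"
  shows "(C - P) \<union> C' \<in> G"
proof -
  define Q where "Q = E - P - {g}"
  have P: "g \<notin> P" "insert g P \<subseteq> X" "r P + r Q \<le> r E + 1"
    using D by (auto simp: del_separation_def Q_def)
  have gf: "g \<noteq> f" using P fP by auto
  have CX: "C \<subseteq> X - {f}" by (rule G_sub[OF C(1)])
  have QP: "Q \<union> P = E - {g}" using P XE by (auto simp: Q_def)
  have rQP: "r (Q \<union> P) = r E" unfolding QP using P by (intro rank_del_singleton) auto
  have eff: "r (S \<union> A) = r S + r A \<and> r (insert f (S \<union> A)) = r (S \<union> P) - r P + r A + 1"
    if A: "A \<subseteq> P - {f}" "r (insert f A) = r A + 1" "r (insert f (Q \<union> A)) = r (Q \<union> A)" and S: "S \<subseteq> Q" for A S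
  proof -
    have "r (Q \<union> P) + r (insert f A) \<le> r (Q \<union> insert f A) + r P"
      using A fP by (intro marginal_antimono) auto
    moreover have "r (Q \<union> A) + r {} \<le> r Q + r A" by (rule submod_le) auto
    ultimately have sk: "r A + r Q \<le> r (A \<union> Q)" "r P + r Q = r E + 1" "r (Q \<union> A) = r Q + r A"
      using rQP A P rank_empty by (auto simp: Un_commute)
    have "r (A \<union> S) = r A + r S" by (rule skew_subset[OF sk(1) _ S]) auto
    moreover have "r (S \<union> insert f A) + r P = r (S \<union> P) + r (insert f A)"
      using A fP S sk rQP by (intro same_contraction_on_subset[where Q = Q]) auto
    ultimately show ?thesis using A by (simp add: Un_commute)
  qed
  have CP: "C \<inter> P \<subseteq> P - {f}" using CX by auto
  have "r (insert f C) + r (C \<inter> P) \<le> r (insert f (C \<inter> P)) + r C"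
    by (rule insert_marginal_antimono) auto
  then have CP2: "r (insert f (C \<inter> P)) = r (C \<inter> P) + 1"
    using G_nonloop[OF C(1)] rank_insert_le[of f "C \<inter> P"] by linarith
  have CP3: "r (insert f (Q \<union> (C \<inter> P))) = r (Q \<union> (C \<inter> P))"
  proof (rule insert_spanned_mono)
    show "(E - X) \<union> C \<subseteq> Q \<union> (C \<inter> P)" using CX C P XE by (auto simp: Q_def)
  qed (use G_noncoloop[OF C(1)] in simp)
  have C'3: "r (insert f (Q \<union> C')) = r (Q \<union> C')" using C' by (simp add: Q_def)
  note e1 = eff[OF C'(1,2) C'3] and e2 = eff[OF CP CP2 CP3]
  show ?thesis
  proof (rule G_closed[OF C(1)])
    show "C - P \<union> C' \<subseteq> X - {f}" using CX C' P by auto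
    fix Y assume Y: "Y \<subseteq> insert f (E - X)"
    let ?S = "(Y - {f}) \<union> (C - P)"
    have S: "?S \<subseteq> Q" "C - P \<subseteq> Q" using Y CX C P XE by (auto simp: Q_def)
    have eqC: "(C - P) \<union> (C \<inter> P) = C" by auto
    note e1' = e1[OF S(1)] e1[OF S(2)] and e2' = e2[OF S(1)] e2[OF S(2), unfolded eqC]
    show "r (Y \<union> (C - P \<union> C')) + r C = r (Y \<union> C) + r (C - P \<union> C')"
    proof (cases "f \<in> Y")
      case True
      then have "Y \<union> (C - P \<union> C') = insert f (?S \<union> C')" "Y \<union> C = insert f (?S \<union> (C \<inter> P))" by auto
      then show ?thesis using e1' e2' by presburger
    next
      case False
      then have "Y \<union> (C - P \<union> C') = ?S \<union> C'" "Y \<union> C = ?S \<union> (C \<inter> P)" by auto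
      then show ?thesis using e1' e2' by presburger
    qed
  qed
qed

text \<open>Linking \<open>f\<close> to the other side after contracting, or deleting,
  \<open>h\<close> yields a new contraction set inside \<open>P\<close> that contains, or avoids,
  \<open>h\<close>. By minimality, a set that blocks the link can only be \<open>{f}\<close>. This
  never blocks contraction, and blocks deletion only if \<open>f\<close>, \<open>h\<close>,
  \<open>g\<close> form a triad.\<close>

lemma minimal_separation_containing_f:
  assumes D: "del_separation r E X g P" and fP: "f \<in> P" and g: "del g"
    and min: "\<And>F. f \<in> F \<Longrightarrow> F \<subset> P \<Longrightarrow> \<not> del_separation r E X g F"
    and h: "h \<in> P" "h \<noteq> f"
  shows "con h" "\<not> triad f h g \<Longrightarrow> del h"
proof -
  define Q where "Q = E - P - {g}"
  have P: "g \<notin> P" "insert g P \<subseteq> X" "r P + r Q \<le> r E + 1"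
    using D by (auto simp: del_separation_def Q_def)
  obtain C where C: "C \<in> G" "g \<notin> C" using g by (auto simp: del_def)
  have hX: "h \<in> X" "g \<in> X" "h \<noteq> g" "g \<noteq> f" using h P fP by auto
  have X': "P - {h} \<subseteq> E - {g, h}" "f \<in> P - {h}" "finite (E - {g, h})"
    "E - {g, h} - (P - {h}) = Q" "{} \<subseteq> P - {h}"
    using P XE h fP finE by (auto simp: Q_def)
  have small: "F = {f}" if F: "f \<in> F" "F \<subseteq> P - {h}" "r F + r (E - F - {g}) \<le> r E + 1" for F
  proof -
    have "\<not> del_separation r E X g F" using min[of F] F h by blast
    then have "card F \<le> 1" using F P unfolding del_separation_def by auto
    moreover have "finite F" using F P rev_finite_subset[OF finX] by blast
    ultimately show ?thesis using F(1) by (auto simp: card_le_Suc0_iff_eq)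
  qed
  let ?r = "\<lambda>S. r (insert h S) - r {h}"
  have "?r (E - {g, h}) < ?r F + ?r (E - {g, h} - F)" if F: "f \<in> F" "F \<subseteq> P - {h}" for F
  proof (rule ccontr)
    assume n: "\<not> ?thesis"
    have e: "insert h (E - {g, h}) = E - {g}" "insert h (E - {g, h} - F) = E - F - {g}"
      using hX XE F by auto
    have le: "r (insert h F) + r (E - F - {g}) \<le> r E + 1"
      using n rank_singleton[OF hX(1)] rank_del_singleton[OF hX(2)] unfolding e by simp
    moreover have "r F \<le> r (insert h F)" by (rule rank_mono) auto
    ultimately have Ff: "F = {f}" by (intro small[OF F]) simp
    have "E - F - {g} = E - {f, g}" using Ff by auto
    then show False using le rank_pair(1)[of h f] rank_pair(2)[of f g] hX h fX unfolding Ff by simp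
  qed
  from linking_with_fixed_contraction[OF contract X'(3,1,2,5) this]
  obtain C' A where C': "C' \<subseteq> P - {h} - {f}" "?r (insert f C') = ?r C' + 1"
    "?r (Q \<union> insert f C') = ?r (Q \<union> C')" unfolding X'(4) by blast
  have "(C - P) \<union> insert h C' \<in> G"
    by (rule separation_containing_f_replace[OF D fP C])
      (use C' h in \<open>auto simp: insert_commute Q_def[symmetric]\<close>)
  then show "con h" unfolding con_def by (rule bexI[rotated]) simp
  assume nt: "\<not> triad f h g"
  have "r (E - {g, h}) < r F + r (E - {g, h} - F)" if F: "f \<in> F" "F \<subseteq> P - {h}" for F
  proof (rule ccontr)
    assume n: "\<not> ?thesis"
    have "r (E - F - {g}) \<le> r (insert h (E - {g, h} - F))" by (rule rank_mono) auto
    moreover have "r (E - {g, h}) \<le> r E" by (rule rank_mono) auto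
    ultimately have Ff: "F = {f}" using n rank_insert_le[of h "E - {g, h} - F"] by (intro small[OF F]) simp
    have e: "E - {g, h} - {f} = E - {f, h, g}" by auto
    have "r (E - {f, h, g}) \<le> r E - 1"
      using n rank_singleton[OF fX] rank_pair(2)[of g h] hX unfolding Ff e by simp
    then show False using nt hX h fX by (auto simp: triad_def)
  qed
  from linking_with_fixed_contraction[OF rank_function_axioms X'(3,1,2,5) this]
  obtain C' A where C': "C' \<subseteq> P - {h} - {f}" "r (insert f C') = r C' + 1"
    "r (Q \<union> insert f C') = r (Q \<union> C')" unfolding X'(4) by blast
  have "(C - P) \<union> C' \<in> G"
    by (rule separation_containing_f_replace[OF D fP C]) (use C' h in \<open>auto simp: Q_def[symmetric]\<close>)
  then show "del h" unfolding del_def by (rule bexI[rotated]) (use C' h in auto)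
qed

lemma obtain_minimal_separation_containing_f:
  assumes "del_separation r E X g P" "f \<in> P"
  obtains P' where "del_separation r E X g P'" "f \<in> P'"
    "\<And>F. f \<in> F \<Longrightarrow> F \<subset> P' \<Longrightarrow> \<not> del_separation r E X g F"
proof -
  define S where "S = {F. f \<in> F \<and> del_separation r E X g F}"
  have "S \<subseteq> Pow X" by (auto simp: S_def del_separation_def)
  then have "finite S" using finX by (meson finite_Pow_iff rev_finite_subset)
  moreover have "P \<in> S" using assms by (auto simp: S_def)
  ultimately obtain P' where "P' \<in> S" "\<And>F. F \<in> S \<Longrightarrow> F \<subseteq> P' \<Longrightarrow> F = P'"
    using finite_has_minimal[of S] by blast
  then show thesis using that[of P'] by (auto simp: S_def)
qed

text \<open>All of \<open>P\<close> is removed, and in the 2-sum along the separation this amounts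
  to deleting or contracting the basepoint of the other side. Which of the two happens depends only
  on whether the contracted part of \<open>P\<close> is skew to \<open>Q\<close>.\<close>

lemma separation_avoiding_f_replace:
  assumes D: "del_separation r E X g P" and fP: "f \<notin> P" and g: "g \<noteq> f" and C: "C \<in> G" "g \<notin> C"
    and Q: "Q = E - P - {g}" and C': "C' \<subseteq> P"
    and iff: "r Q + r C' \<le> r (Q \<union> C') \<longleftrightarrow> r Q + r (C \<inter> P) \<le> r (Q \<union> (C \<inter> P))"
  shows "(C - P) \<union> C' \<in> G"
proof -
  have P: "g \<notin> P" "insert g P \<subseteq> X" "r P + r Q \<le> r E + 1"
    using D by (auto simp: del_separation_def Q)
  have CX: "C \<subseteq> X - {f}" by (rule G_sub[OF C(1)])
  have QP: "Q \<union> P = E - {g}" using P XE by (auto simp: Q)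
  have rQP: "r (Q \<union> P) = r E" unfolding QP using P by (intro rank_del_singleton) auto
  have "r (S \<union> C') + r (C \<inter> P) = r (S \<union> (C \<inter> P)) + r C'" if S: "S \<subseteq> Q" for S
  proof (cases "r Q + r C' \<le> r (Q \<union> C')")
    case True
    then show ?thesis using iff skew_subset[OF _ S, of C' C'] skew_subset[OF _ S, of "C \<inter> P" "C \<inter> P"] by simp
  next
    case False
    have full: "r (S \<union> A) + r P = r (S \<union> P) + r A" if "A \<subseteq> P" "r (Q \<union> A) < r Q + r A" for A
      using that S P rQP by (intro same_contraction_on_subset[where Q = Q]) auto
    show ?thesis using full[of C'] full[of "C \<inter> P"] False iff C' by auto
  qed
  note e = this
  show ?thesis
  proof (rule G_closed[OF C(1)])
    show "C - P \<union> C' \<subseteq> X - {f}" using CX C' P fP by auto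
    fix Y assume Y: "Y \<subseteq> insert f (E - X)"
    have S: "Y \<union> (C - P) \<subseteq> Q" "C - P \<subseteq> Q" using Y CX C P XE fP fX g by (auto simp: Q)
    have "Y \<union> (C - P) \<union> (C \<inter> P) = Y \<union> C" "(C - P) \<union> (C \<inter> P) = C" by auto
    then show "r (Y \<union> (C - P \<union> C')) + r C = r (Y \<union> C) + r (C - P \<union> C')"
      using e[OF S(1)] e[OF S(2)] by (simp add: Un_assoc)
  qed
qed

text \<open>Contracting nothing in \<open>P\<close>, or exactly \<open>P - {a}\<close>, would delete
  \<open>a\<close>. Hence the contracted part of \<open>P\<close> is not skew to the other side,
  \<open>P - {a}\<close> is, and contracting all of \<open>P\<close> gives the same minor.\<close>

lemma separation_avoiding_f_not_del:
  assumes D: "del_separation r E X g P" and fP: "f \<notin> P" and g: "g \<noteq> f" "del g"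
    and a: "a \<in> P" "\<not> del a"
  shows "r (E - P - {g}) + r (P - {a}) \<le> r ((E - P - {g}) \<union> (P - {a}))"
    "h \<in> P \<Longrightarrow> con h" "r P + r (E - P - {g}) = r E + 1"
proof -
  define Q where "Q = E - P - {g}"
  obtain C where C: "C \<in> G" "g \<notin> C" using g by (auto simp: del_def)
  note rep = separation_avoiding_f_replace[OF D fP g(1) C Q_def]
  have nskew: "\<not> r Q + r (C \<inter> P) \<le> r (Q \<union> (C \<inter> P))"
  proof
    assume "r Q + r (C \<inter> P) \<le> r (Q \<union> (C \<inter> P))"
    then have "(C - P) \<union> {} \<in> G" using rank_empty by (intro rep) auto
    then show False using a by (auto simp: del_def)
  qed
  have "r Q + r (P - {a}) \<le> r (Q \<union> (P - {a}))"
  proof (rule ccontr)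
    assume "\<not> ?thesis"
    then have "(C - P) \<union> (P - {a}) \<in> G" using nskew by (intro rep) auto
    then show False using a by (auto simp: del_def)
  qed
  then show "r (E - P - {g}) + r (P - {a}) \<le> r ((E - P - {g}) \<union> (P - {a}))" by (simp add: Q_def)
  have nP: "\<not> r Q + r P \<le> r (Q \<union> P)"
    using nskew skew_subset[of Q P Q "C \<inter> P"] by auto
  then have PG: "(C - P) \<union> P \<in> G" using nskew by (intro rep) auto
  show "con h" if "h \<in> P" using PG that by (auto simp: con_def)
  have P: "g \<notin> P" "insert g P \<subseteq> X" "r P + r Q \<le> r E + 1"
    using D by (auto simp: del_separation_def Q_def)
  have QP: "Q \<union> P = E - {g}" using P XE by (auto simp: Q_def)
  have rQP: "r (Q \<union> P) = r E" unfolding QP using P by (intro rank_del_singleton) auto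
  show "r P + r (E - P - {g}) = r E + 1" using nP P rQP unfolding Q_def[symmetric] by linarith
qed

text \<open>Skewness to the other side makes \<open>P - {a}\<close> and \<open>P - {h}\<close> lose
  rank against \<open>P\<close>. Removing both elements lowers the rank by 2 while the two sides
  overlap only in rank 1, so the complement of \<open>{g, a, h}\<close> is not spanning.\<close>

lemma separation_avoiding_f_two_not_del:
  assumes D: "del_separation r E X g P" and fP: "f \<notin> P" and g: "g \<noteq> f" "del g"
    and a: "a \<in> P" "\<not> del a" and h: "h \<in> P" "\<not> del h" "h \<noteq> a"
  shows "triad g a h"
proof -
  define Q where "Q = E - P - {g}"
  have P: "g \<notin> P" "insert g P \<subseteq> X" using D by (auto simp: del_separation_def)
  note na = separation_avoiding_f_not_del[OF D fP g a, folded Q_def]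
  note nh = separation_avoiding_f_not_del[OF D fP g h(1,2), folded Q_def]
  have "r (Q \<union> (P - {a})) \<le> r E" "r (Q \<union> (P - {h})) \<le> r E"
    using P XE by (auto simp: Q_def intro!: rank_mono)
  moreover have "r P + r (P - {a} - {h}) \<le> r (P - {a}) + r (P - {h})"
    using h by (intro submod_le) auto
  moreover have "r (Q \<union> (P - {a} - {h})) = r Q + r (P - {a} - {h})"
    by (rule skew_subset[OF na(1)]) auto
  moreover have "E - {g, a, h} = Q \<union> (P - {a} - {h})" using P XE a h by (auto simp: Q_def)
  ultimately have "r (E - {g, a, h}) \<le> r E - 1" using na nh by simp
  then show ?thesis using P a h by (auto simp: triad_def)
qed

text \<open>If two elements of \<open>P\<close> cannot be contracted, both are spanned by the other
  side. They are independent and lie in the closure of both sides, too much for \<lambda> \<le>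
  1.\<close>

lemma separation_avoiding_f_not_con:
  assumes D: "del_separation r E X g P" and fP: "f \<notin> P" and g: "g \<noteq> f" "del g"
    and a: "a \<in> P" "\<not> con a" and h: "h \<in> P" "h \<noteq> a"
  shows "con h"
proof (rule ccontr)
  assume nh: "\<not> con h"
  define Q where "Q = E - P - {g}"
  obtain C where C: "C \<in> G" "g \<notin> C" using g by (auto simp: del_def)
  note rep = separation_avoiding_f_replace[OF D fP g(1) C Q_def]
  have P: "g \<notin> P" "insert g P \<subseteq> X" "r P + r Q \<le> r E + 1"
    using D by (auto simp: del_separation_def Q_def)
  have skew: "r Q + r (C \<inter> P) \<le> r (Q \<union> (C \<inter> P))"
  proof (rule ccontr)
    assume n: "\<not> ?thesis"
    then have "\<not> r Q + r P \<le> r (Q \<union> P)" using skew_subset[of Q P Q "C \<inter> P"] by auto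
    then have "(C - P) \<union> P \<in> G" using n by (intro rep) auto
    then show False using a by (auto simp: con_def)
  qed
  have nsk: "r (insert x Q) \<le> r Q" if "x \<in> P" "\<not> con x" for x
  proof (rule ccontr)
    assume "\<not> ?thesis"
    then have "r Q + r {x} \<le> r (Q \<union> {x})" using rank_singleton_le[of x] by auto
    then have "(C - P) \<union> {x} \<in> G" using skew that by (intro rep) auto
    then show False using that by (auto simp: con_def)
  qed
  have "r (insert h (insert a Q)) = r (insert a Q)" by (rule insert_spanned_mono[OF _ nsk[OF h(1) nh]]) auto
  then have "r (Q \<union> {h, a}) \<le> r Q" using nsk[OF a] by (simp add: insert_commute)
  moreover have "r (Q \<union> P) + r {h, a} \<le> r (Q \<union> {h, a}) + r P"
    using a h by (intro marginal_antimono) auto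
  moreover have "Q \<union> P = E - {g}" using P XE by (auto simp: Q_def)
  moreover have "r (E - {g}) = r E" using P by (intro rank_del_singleton) auto
  moreover have "r {h, a} = 2" using a h P by (intro rank_pair) auto
  ultimately show False using P by simp
qed

text \<open>Wherever \<open>f\<close> lies, the outcome is a triad through \<open>g\<close> or an
  element of the side that can be both deleted and contracted, to which Bixby's uncrossing
  applies.\<close>

lemma separation_triple:
  assumes D: "del_separation r E X g P" and g: "g \<noteq> f" "del g"
  shows "\<exists>a b c. triangle a b c \<or> triad a b c"
proof (cases "\<exists>P. del_separation r E X g P \<and> f \<in> P")
  case True
  then obtain P where P: "del_separation r E X g P" "f \<in> P"
    "\<And>F. f \<in> F \<Longrightarrow> F \<subset> P \<Longrightarrow> \<not> del_separation r E X g F"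
    using obtain_minimal_separation_containing_f by metis
  then have "P - {f} \<noteq> {}" by (intro card2_remove_nonempty) (auto simp: del_separation_def)
  then obtain h where h: "h \<in> P" "h \<noteq> f" by auto
  then have "h \<in> X" using P by (auto simp: del_separation_def)
  then show ?thesis
    using minimal_separation_containing_f[OF P(1,2) g(2) P(3) h] del_con_triple[OF _ h(2)] by blast
next
  case False
  then have fP: "f \<notin> P" using D by auto
  have P: "2 \<le> card P" "P \<subseteq> X" using D by (auto simp: del_separation_def)
  obtain a where a: "a \<in> P" using P by fastforce
  obtain h where h: "h \<in> P" "h \<noteq> a" using card2_remove_nonempty[OF P(1), of a] by auto
  have "(\<exists>x\<in>P. del x \<and> con x) \<or> triad g a h"
    using separation_avoiding_f_two_not_del[OF D fP g a _ h(1) _ h(2)]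
      separation_avoiding_f_not_del(2)[OF D fP g a _ h(1)] separation_avoiding_f_not_del(2)[OF D fP g h(1) _ a]
      separation_avoiding_f_not_con[OF D fP g a _ h] del_or_con[of a] del_or_con[of h] a h by blast
  then show ?thesis using del_con_triple P fP by blast
qed

text \<open>Both elements lie in every member of \<open>G\<close> and in the closure of
  \<open>E - X\<close>. As \<lambda>(X) \<le> 2, contracting two independent such elements
  disconnects \<open>X\<close> from \<open>E - X\<close>, and \<open>f\<close> could not be a
  non-loop spanned by \<open>E - X\<close>.\<close>

lemma guts_unique:
  assumes u: "u \<in> X" "\<not> del u" "r (insert u (E - X)) = r (E - X)"
    and v: "v \<in> X" "\<not> del v" "r (insert v (E - X)) = r (E - X)" and "u \<noteq> v"
  shows False
proof -
  obtain C where C: "C \<in> G" using G_nonempty by auto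
  have uv: "u \<in> C" "v \<in> C" using u v C by (auto simp: del_def)
  have CX: "C \<subseteq> X - {f}" by (rule G_sub[OF C])
  let ?B = "E - X"
  have "r (insert u (insert v ?B)) = r (insert v ?B)" by (rule insert_spanned_mono[of ?B]) (use u in auto)
  then have "r (insert u (insert v ?B)) = r ?B" using v by simp
  moreover have "r (?B \<union> C) + r {u, v} \<le> r (insert u (insert v ?B)) + r C"
    using uv by (intro submod_le) auto
  moreover have "r {u, v} = 2" using u v assms by (intro rank_pair) auto
  moreover have "r E + r (insert f C) \<le> r X + r (insert f (?B \<union> C))"
    using CX XE fX by (intro submod_le) auto
  ultimately show False using G_nonloop[OF C] G_noncoloop[OF C] connX by simp
qed

lemma coguts_unique:
  assumes u: "u \<in> X - {f}" "\<not> con u" "r (X - {u}) < r X"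
    and v: "v \<in> X - {f}" "\<not> con v" "r (X - {v}) < r X" and "u \<noteq> v"
  shows False
proof -
  have "dual E (insert x (E - X)) = dual E (E - X)" if "x \<in> X" "r (X - {x}) < r X" for x
  proof -
    have s: "insert x (E - X) = E - (X - {x})" "X - {x} \<subseteq> E" "insert x (X - {x}) = X" using that XE by auto
    have "r X \<le> r (X - {x}) + 1" using rank_insert_le[of x "X - {x}"] unfolding s(3) .
    then show ?thesis using that card_Suc_Diff1[of X x] finX
      unfolding s(1) dual_compl_eq[OF finE s(2)] dual_compl_eq[OF finE XE] by simp
  qed
  then show False using obstruction.guts_unique[OF dual_obstruction, of u v] u v \<open>u \<noteq> v\<close> by (auto simp: dual_del)
qed

text \<open>Otherwise each element of \<open>X - {f}\<close> is spanned by \<open>E - X\<close> and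
  not deletable, or lowers the rank of \<open>X\<close> when removed and is not contractible. There
  is at most one of either kind, so \<open>X\<close> has exactly three elements, and the ranks then
  contradict \<lambda>(X) \<le> 2.\<close>

lemma separable_exists:
  "\<exists>g\<in>X - {f}. (del g \<and> (\<exists>P. del_separation r E X g P)) \<or> (con g \<and> (\<exists>P. con_separation r E X g P))"
proof (rule ccontr)
  assume n: "\<not> ?thesis"
  let ?B = "E - X"
  have mo: "r (X - {x}) \<le> r X" for x by (rule rank_mono) auto
  have mo2: "r ?B \<le> r (insert x ?B)" for x by (rule rank_mono) auto
  have g: "con x \<Longrightarrow> r (insert x ?B) = r ?B" if "x \<in> X - {f}" for x
    using con_sep[of _ x] n that rank_insert_le[of x ?B] mo2[of x] by (force simp: con_def)
  have c: "del x \<Longrightarrow> r (X - {x}) < r X" if "x \<in> X - {f}" for x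
    using del_sep[of _ x] n that mo[of x] by (force simp: del_def)
  have dich: "(\<not> del x \<and> r (insert x ?B) = r ?B) \<or> (\<not> con x \<and> r (X - {x}) < r X)" if x: "x \<in> X - {f}" for x
    using g[OF x] c[OF x] del_not_guts[of x] con_not_coguts[of x] del_or_con[of x] x by fastforce
  have fin: "finite (X - {f})" "card (X - {f}) = card X - 1" using finX fX by auto
  have one: "card S \<le> 1" if "S \<subseteq> X - {f}" "\<And>u v. u \<in> S \<Longrightarrow> v \<in> S \<Longrightarrow> u = v" for S
    using that fin rev_finite_subset[of "X - {f}" S] by (auto simp: card_le_Suc0_iff_eq)
  define S1 where "S1 = {x \<in> X - {f}. \<not> del x \<and> r (insert x ?B) = r ?B}"
  define S2 where "S2 = {x \<in> X - {f}. \<not> con x \<and> r (X - {x}) < r X}"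
  have 1: "card S1 \<le> 1" using guts_unique by (intro one) (auto simp: S1_def)
  have 2: "card S2 \<le> 1" using coguts_unique by (intro one) (auto simp: S2_def)
  have un: "X - {f} = S1 \<union> S2" using dich by (auto simp: S1_def S2_def)
  then have "card X \<le> 1 + (card S1 + card S2)" using card_Un_le[of S1 S2] fin by simp
  then have "card S1 = 1" "card S2 = 1" using 1 2 cardX by auto
  then obtain u v where uv: "S1 = {u}" "S2 = {v}" by (auto simp: card_1_singleton_iff)
  then have X: "X = {f, u, v}" using un fX by auto
  have u: "u \<in> X - {f}" "r (insert u ?B) = r ?B" using uv by (auto simp: S1_def)
  have v: "v \<in> X - {f}" "r (X - {v}) < r X" using uv by (auto simp: S2_def)
  have "u \<noteq> v"
  proof
    assume "u = v"
    then have "card X \<le> 2" using X by (simp add: card_insert_if)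
    then show False using cardX by simp
  qed
  have e: "X - {v} = {f, u}" "E - {f, v} = insert u ?B" using X u v \<open>u \<noteq> v\<close> XE by auto
  have "r X \<ge> 3" using v rank_pair(1)[of f u] u fX unfolding e by auto
  moreover have "r E + 2 \<le> r {f, v} + r (insert u ?B)"
    using conn2[of "{f, v}"] u v fX unfolding e(2) by auto
  ultimately show False using u connX rank_pair_le[of f v] by simp
qed

text \<open>Bixby's triple through \<open>h\<close> contains \<open>f\<close>. A triad would share a
  second element with the triangle by orthogonality and form a fan with it.\<close>

lemma del_con_triangle_with_f:
  assumes tri: "triangle f a b" and h: "h \<in> X" "h \<noteq> f" "h \<noteq> a" "h \<noteq> b" "del h" "con h"
  shows "\<exists>k. triangle h f k \<and> \<not> del k"
proof -
  obtain u v where uv: "triangle h u v \<or> triad h u v" using del_con_triple[OF h(1,2,5,6)] by auto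
  then obtain k where k: "triangle h f k \<or> triad h f k"
    using triangle_has_f[of h u v] triad_has_f[of h u v] triangle_perms(1)[of h u v] triad_perms(1)[of h u v] h(2)
    by auto
  have "\<not> triad h f k"
  proof
    assume t: "triad h f k"
    then have "a \<in> {h, k} \<or> b \<in> {h, k}" using orthogonal[OF triad_perms(2)[OF t] tri] by auto
    then have "k = a \<or> k = b" using h by auto
    then show False
      using triangle_triad_no_common_pair[OF tri, of h] triangle_triad_no_common_pair[OF triangle_perms(1)[OF tri], of h]
        triad_perms(3)[OF t] by auto
  qed
  then have t: "triangle h f k" using k by auto
  then have "\<not> del k" using triangle_not_both_del[OF triangle_perms(1)[OF t]] h triangleD[OF t] by auto
  then show ?thesis using t by auto
qed

lemma no_mixed_triangle:
  assumes tri: "triangle f a b" and a: "\<not> del a" and b: "del b"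
  shows False
proof -
  note d = triangleD[OF tri]
  have bf: "b \<noteq> f" "a \<noteq> f" using d by auto
  obtain P0 where P0: "del_separation r E X b P0"
    using triangle_del_separation[OF triangle_perms(5)[OF tri] bf(1) b] by auto
  show False
  proof (cases "\<exists>P. del_separation r E X b P \<and> f \<in> P")
    case True
    then obtain P where P: "del_separation r E X b P" "f \<in> P"
      "\<And>F. f \<in> F \<Longrightarrow> F \<subset> P \<Longrightarrow> \<not> del_separation r E X b F"
      using obtain_minimal_separation_containing_f by metis
    define Q where "Q = E - P - {b}"
    have P': "b \<notin> P" "insert b P \<subseteq> X" "2 \<le> card P" "r P + r Q \<le> r E + 1"
      using P(1) by (auto simp: del_separation_def Q_def)
    have aP: "a \<notin> P" using del_separation_splits[OF triangle_perms(5)[OF tri] P(1)] P(2) by auto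
    have both: "con h \<and> del h" if h: "h \<in> P" "h \<noteq> f" for h
      using minimal_separation_containing_f[OF P(1,2) b P(3) h] triad_perms(1)[of f h b]
        triangle_triad_no_common_pair[OF triangle_perms(1)[OF tri], of h] by auto
    obtain h where h: "h \<in> P" "h \<noteq> f" using card2_remove_nonempty[OF P'(3), of f] by auto
    have "h \<in> X" "h \<noteq> a" "h \<noteq> b" using h P' aP by auto
    then obtain k where k: "triangle h f k" "\<not> del k"
      using del_con_triangle_with_f[OF tri _ h(2)] both[OF h] by auto
    have kn: "k \<notin> P" "k \<noteq> b" "k \<in> X" using both[of k] k triangleD[OF k(1)] b by auto
    obtain C where C: "C \<in> G" "b \<notin> C" using b by (auto simp: del_def)
    \<comment> \<open>\<open>k\<close> lies in \<open>Q\<close> and in the closure of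
      \<open>P\<close>, so it is parallel to the basepoint of the 2-sum. Contracting it, as
      \<open>C\<close> does, separates \<open>P\<close> from \<open>Q\<close>, and \<open>f\<close>
      cannot be both a non-loop and spanned from \<open>Q\<close>.\<close>
    have kC: "k \<in> C" using k C by (auto simp: del_def)
    have CX: "C \<subseteq> X - {f}" by (rule G_sub[OF C(1)])
    let ?CP = "C \<inter> P"
    have "r (insert f (Q \<union> ?CP)) = r (Q \<union> ?CP)"
    proof (rule insert_spanned_mono)
      show "(E - X) \<union> C \<subseteq> Q \<union> ?CP" using CX C P' XE by (auto simp: Q_def)
    qed (use G_noncoloop[OF C(1)] in simp)
    moreover have "r (insert k P) = r P"
      by (rule triangle_span[OF triangle_perms(4)[OF k(1)]]) (use h P in auto)
    moreover have "r (E - {b}) + r (insert f (insert k ?CP)) \<le> r (insert k P) + r (insert f (Q \<union> ?CP))"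
      by (rule submod_le) (use kn XE P in \<open>auto simp: Q_def\<close>)
    moreover have "r (Q \<union> ?CP) + r {k} \<le> r Q + r (insert k ?CP)"
      by (rule submod_le) (use kn XE in \<open>auto simp: Q_def\<close>)
    moreover have "r (insert f C) + r (insert k ?CP) \<le> r (insert f (insert k ?CP)) + r C"
      by (rule insert_marginal_antimono) (use kC in auto)
    ultimately show False
      using rank_del_singleton[of b] rank_singleton[OF kn(3)] d P' G_nonloop[OF C(1)] by auto
  next
    case False
    define Q where "Q = E - P0 - {b}"
    have fP: "f \<notin> P0" using False P0 by auto
    have P': "b \<notin> P0" "insert b P0 \<subseteq> X" "2 \<le> card P0" using P0 by (auto simp: del_separation_def)
    have aP: "a \<in> P0" using del_separation_splits[OF triangle_perms(5)[OF tri] P0] fP by auto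
    note na = separation_avoiding_f_not_del[OF P0 fP bf(1) b aP a, folded Q_def]
    have dl: "del h" if h: "h \<in> P0" "h \<noteq> a" for h
    proof (rule ccontr)
      assume "\<not> del h"
      then have "triad b a h" using separation_avoiding_f_two_not_del[OF P0 fP bf(1) b aP a] h by auto
      then show False using triangle_triad_no_common_pair[OF triangle_perms(5)[OF tri]] by auto
    qed
    obtain h where h: "h \<in> P0" "h \<noteq> a" using card2_remove_nonempty[OF P'(3), of a] by auto
    have hX: "h \<in> X" "h \<noteq> f" "h \<noteq> b" using h P' fP by auto
    then obtain k where k: "triangle h f k" "\<not> del k"
      using del_con_triangle_with_f[OF tri hX(1,2) h(2) hX(3)] dl[OF h] na(2)[OF h(1)] by auto
    \<comment> \<open>If \<open>k = a\<close>, then \<open>b\<close>, \<open>a\<close>,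
      \<open>h\<close> form a triangle with \<open>a\<close> and \<open>h\<close> on the same side
      of the separation at \<open>b\<close>.\<close>
    have ka: "k \<noteq> a"
    proof
      assume "k = a"
      then have t: "triangle h f a" using k by auto
      have "r (insert h {a, f}) = r {a, f}" by (rule triangle_span[OF t]) auto
      moreover have "r (insert b {h, a, f}) = r {h, a, f}"
        by (rule triangle_span[OF triangle_perms(5)[OF tri]]) auto
      moreover have "r {b, a, h} \<le> r (insert b {h, a, f})" by (rule rank_mono) auto
      ultimately have "triangle b a h" using d h hX rank_pair(1)[of a f] by (auto simp: triangle_def)
      then show False using del_separation_splits[OF _ P0] aP h by auto
    qed
    have kn: "k \<notin> P0" "k \<noteq> b" "k \<in> X" using dl[of k] ka k triangleD[OF k(1)] b by auto
    \<comment> \<open>\<open>f\<close> and \<open>k\<close> lie in \<open>Q\<close> and span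
      \<open>h\<close>, whereas \<open>P0 - {a}\<close>, which contains \<open>h\<close>, is skew to
      \<open>Q\<close>.\<close>
    have "r (insert h Q) = r Q"
      by (rule triangle_span[OF k(1)]) (use kn XE fP fX bf in \<open>auto simp: Q_def\<close>)
    moreover have "r (Q \<union> {h}) = r Q + r {h}" by (rule skew_subset[OF na(1)]) (use h in auto)
    ultimately show False using rank_singleton[OF hX(1)] by simp
  qed
qed

lemma no_triangle: "\<not> triangle a b c"
proof
  assume t: "triangle a b c"
  have False if t: "triangle f a b" for a b
  proof -
    have n: "a \<noteq> f" "b \<noteq> f" using triangleD[OF t] by auto
    note t2 = triangle_perms(3)[OF t]
    have "\<not> (del a \<and> del b)" using triangle_not_both_del[OF t2] n by auto
    moreover have "del a \<or> del b" using triangle_con_imp_del[OF t2] n del_or_con[of a] by auto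
    ultimately show False using no_mixed_triangle[OF t] no_mixed_triangle[OF triangle_perms(1)[OF t]] by auto
  qed
  then show False using triangle_has_f[OF t] t triangle_perms[OF t] by auto
qed

lemma inconsistent: False
proof -
  have nt: "\<not> triangle a b c" "\<not> triad a b c" for a b c
    using no_triangle obstruction.no_triangle[OF dual_obstruction] unfolding dual_triangle by auto
  obtain g where g: "g \<in> X - {f}"
    "(del g \<and> (\<exists>P. del_separation r E X g P)) \<or> (con g \<and> (\<exists>P. con_separation r E X g P))"
    using separable_exists by blast
  from g(2) show False
  proof
    assume "del g \<and> (\<exists>P. del_separation r E X g P)"
    then show False using separation_triple[of g] g(1) nt by blast
  next
    assume "con g \<and> (\<exists>P. con_separation r E X g P)"
    then have "\<exists>a b c. triad a b c \<or> triangle a b c"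
      using obstruction.separation_triple[OF dual_obstruction, of g] g(1)
      unfolding dual_triangle dual_triad dual_del_separation[OF finE XE] by (auto simp: dual_del)
    then show False using nt by blast
  qed
qed

end

section \<open>Tangle lines\<close>

text \<open>Values of \<open>rk\<close> outside the subsets of the ground set are arbitrary; intersecting with the ground
set makes the rank axioms hold for all sets.\<close>

definition irk :: "'a matroid \<Rightarrow> 'a set \<Rightarrow> int" where
  "irk M S = int (rk M (S \<inter> gr M))"

lemma matroid_rank_function:
  assumes "matroid M" shows "rank_function (irk M)"
proof -
  have ax: "\<And>X. X \<subseteq> gr M \<Longrightarrow> rk M X \<le> card X"
    "\<And>X Y. X \<subseteq> Y \<Longrightarrow> Y \<subseteq> gr M \<Longrightarrow> rk M X \<le> rk M Y"
    "\<And>X Y. X \<subseteq> gr M \<Longrightarrow> Y \<subseteq> gr M \<Longrightarrow> rk M (X \<union> Y) + rk M (X \<inter> Y) \<le> rk M X + rk M Y"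
    using assms by (auto simp: matroid_def)
  show ?thesis
  proof
    show "irk M {} = 0" using ax(1)[of "{}"] by (simp add: irk_def)
  next
    fix S T :: "'a set" assume "S \<subseteq> T"
    then have "rk M (S \<inter> gr M) \<le> rk M (T \<inter> gr M)" by (intro ax(2)) auto
    then show "irk M S \<le> irk M T" by (simp add: irk_def)
  next
    fix S T
    have "(S \<union> T) \<inter> gr M = (S \<inter> gr M) \<union> (T \<inter> gr M)" "(S \<inter> T) \<inter> gr M = (S \<inter> gr M) \<inter> (T \<inter> gr M)" by auto
    then show "irk M (S \<union> T) + irk M (S \<inter> T) \<le> irk M S + irk M T"
      using ax(3)[of "S \<inter> gr M" "T \<inter> gr M"] by (simp add: irk_def)
  next
    fix x S
    show "irk M (insert x S) \<le> irk M S + 1"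
    proof (cases "x \<in> gr M")
      case True
      then have "insert x S \<inter> gr M = (S \<inter> gr M) \<union> {x}" by auto
      then show ?thesis using ax(3)[of "S \<inter> gr M" "{x}"] ax(1)[of "{x}"] True by (simp add: irk_def)
    qed (simp add: irk_def)
  qed
qed

section \<open>The line as a member of the tangle\<close>

locale tangle_line =
  fixes M :: "'a matroid" and \<theta> :: nat and T :: "'a set set" and X :: "'a set"
  assumes matM: "matroid M" and conn3: "three_connected M" and tang: "tangle M \<theta> T"
    and theta: "3 \<le> \<theta>" and long: "long_line (tangle_matroid M \<theta> T) X"
begin

abbreviation (input) E where "E \<equiv> gr M"
abbreviation (input) r where "r \<equiv> irk M"

sublocale rank_function "irk M" by (rule matroid_rank_function[OF matM])

lemma finE: "finite E" using matM by (simp add: matroid_def)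

lemma irk_eq: "S \<subseteq> E \<Longrightarrow> r S = int (rk M S)"
  by (simp add: irk_def inf.absorb1)

lemma conn_eq:
  assumes "Y \<subseteq> E" shows "int (conn M Y) = r Y + r (E - Y) - r E"
proof -
  have "r E + r {} \<le> r Y + r (E - Y)" by (rule submod_le) auto
  then show ?thesis using assms rank_empty irk_eq[of E] irk_eq[of "E - Y"] irk_eq[of Y]
    by (simp add: conn_def)
qed

lemma three_conn:
  assumes "Y \<subseteq> E" "k \<le> card Y" "k \<le> card (E - Y)" "k \<le> 2"
  shows "r E + int k \<le> r Y + r (E - Y)"
proof (cases "k = 0")
  case True
  have "r E + r {} \<le> r Y + r (E - Y)" by (rule submod_le) auto
  then show ?thesis using True rank_empty by simp
next
  case False
  then have "\<not> conn M Y < k" using conn3 assms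
    by (auto simp: three_connected_def k_separation_def)
  then show ?thesis using conn_eq[OF assms(1)] by linarith
qed

lemma T_sub: "Z \<in> T \<Longrightarrow> Z \<subseteq> E"
  and T_cover: "Z1 \<in> T \<Longrightarrow> Z2 \<in> T \<Longrightarrow> Z3 \<in> T \<Longrightarrow> Z1 \<union> Z2 \<union> Z3 \<noteq> E"
  and T_compl_single: "x \<in> E \<Longrightarrow> E - {x} \<notin> T"
  using tang by (auto simp: tangle_def)

lemma T_or:
  assumes "Z \<subseteq> E" "r Z + r (E - Z) \<le> r E + 2" shows "Z \<in> T \<or> E - Z \<in> T"
proof -
  \<comment> \<open>Order at least 3 is what makes the tangle decide every set with \<lambda> \<le>
    2.\<close>
  have "conn M Z < \<theta>" using conn_eq[OF assms(1)] assms(2) theta by linarith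
  then show ?thesis using tang assms(1) by (auto simp: tangle_def)
qed

lemma T_single: assumes "x \<in> E" shows "{x} \<in> T"
proof -
  have "r (E - {x}) \<le> r E" by (rule rank_mono) auto
  then show ?thesis using T_or[of "{x}"] T_compl_single[OF assms] assms rank_singleton_le[of x] by auto
qed

lemma tangle_rank_le:
  assumes "Y \<in> T" "S \<subseteq> Y" shows "tangle_rank M \<theta> T S \<le> conn M Y"
proof -
  have "finite T" using T_sub finE by (meson Pow_iff finite_Pow_iff rev_finite_subset subsetI)
  then have "finite {conn M Y | Y. Y \<in> T \<and> S \<subseteq> Y}" by simp
  then show ?thesis using assms by (auto simp: tangle_rank_def intro!: Min_le)
qed

lemma tangle_rank_ge:
  assumes "\<And>Y. Y \<in> T \<Longrightarrow> S \<subseteq> Y \<Longrightarrow> k \<le> conn M Y" "k \<le> \<theta>"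
  shows "k \<le> tangle_rank M \<theta> T S"
proof -
  have "finite T" using T_sub finE by (meson Pow_iff finite_Pow_iff rev_finite_subset subsetI)
  then have "finite {conn M Y | Y. Y \<in> T \<and> S \<subseteq> Y}" by simp
  then show ?thesis using assms by (auto simp: tangle_rank_def intro!: Min.boundedI)
qed

lemma
  shows X_sub: "X \<subseteq> E" and X_card: "3 \<le> card X" and X_rank: "tangle_rank M \<theta> T X = 2"
    and X_closed: "e \<in> E - X \<Longrightarrow> tangle_rank M \<theta> T (insert e X) \<noteq> 2"
  using long by (auto simp: long_line_def line_def closed_set_def tangle_matroid_def gr_def rk_def)

lemma conn_above_X:
  assumes "Y \<in> T" "X \<subseteq> Y" shows "2 \<le> conn M Y"
  using tangle_rank_le[OF assms] X_rank by simp

lemma X_maximal: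
  assumes "Y \<in> T" "X \<subseteq> Y" "conn M Y \<le> 2" shows "Y = X"
proof (rule ccontr)
  assume "Y \<noteq> X"
  then obtain e where e: "e \<in> Y" "e \<notin> X" using assms by auto
  have "tangle_rank M \<theta> T (insert e X) \<le> 2"
    using tangle_rank_le[OF assms(1), of "insert e X"] assms e by simp
  moreover have "2 \<le> tangle_rank M \<theta> T (insert e X)"
    using conn_above_X theta by (intro tangle_rank_ge) auto
  ultimately show False using X_closed[of e] e T_sub[OF assms(1)] by auto
qed

lemma X_in_T: "X \<in> T" "r X + r (E - X) = r E + 2"
proof -
  have "\<exists>Y\<in>T. X \<subseteq> Y \<and> conn M Y \<le> 2"
  proof (rule ccontr)
    assume "\<not> ?thesis"
    then have "3 \<le> tangle_rank M \<theta> T X" using theta by (intro tangle_rank_ge) force+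
    then show False using X_rank by simp
  qed
  then obtain Y where Y: "Y \<in> T" "X \<subseteq> Y" "conn M Y \<le> 2" by auto
  then have "Y = X" by (rule X_maximal)
  then show "X \<in> T" using Y by simp
  have "conn M X = 2" using conn_above_X[OF \<open>X \<in> T\<close>] Y \<open>Y = X\<close> by simp
  then show "r X + r (E - X) = r E + 2" using conn_eq[OF X_sub] by simp
qed

lemma card_compl_X: "2 \<le> card (E - X)"
proof (rule ccontr)
  assume "\<not> ?thesis"
  then have "card (E - X) = 0 \<or> card (E - X) = 1" by auto
  then show False
  proof
    assume "card (E - X) = 0"
    then have "X \<union> X \<union> X = E" using finE X_sub by auto
    then show False using T_cover X_in_T by blast
  next
    assume "card (E - X) = 1"
    then obtain b where b: "E - X = {b}" by (auto simp: card_1_singleton_iff)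
    then have "X = E - {b}" "b \<in> E" using X_sub by auto
    then show False using T_compl_single[of b] X_in_T by simp
  qed
qed

lemma card_compl_subset:
  assumes "Y \<subseteq> X" shows "2 \<le> card (E - Y)"
proof -
  have "card (E - X) \<le> card (E - Y)" using assms finE by (intro card_mono) auto
  then show ?thesis using card_compl_X by simp
qed

text \<open>As \<lambda>(Z \<inter> X) \<ge> 2 by 3-connectivity, uncrossing gives \<lambda>(Z
  \<union> X) \<le> 2. The complement of the union is not in the tangle, since with \<open>Z\<close>
  and \<open>X\<close> it would cover \<open>E\<close>; so the union is, and maximality of
  \<open>X\<close> applies.\<close>

lemma T_sub_X:
  assumes Z: "Z \<in> T" "r Z + r (E - Z) \<le> r E + 2" and xy: "x \<in> Z \<inter> X" "y \<in> Z \<inter> X" "x \<noteq> y"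
  shows "Z \<subseteq> X"
proof -
  have ZE: "Z \<subseteq> E" by (rule T_sub[OF Z(1)])
  have "finite (Z \<inter> X)" using X_sub finE finite_subset by blast
  then have "card {x, y} \<le> card (Z \<inter> X)" using xy by (intro card_mono) auto
  then have "r E + int 2 \<le> r (Z \<inter> X) + r (E - (Z \<inter> X))"
    using xy X_sub card_compl_subset[of "Z \<inter> X"] by (intro three_conn) auto
  moreover have "r (Z \<union> X) + r (Z \<inter> X) \<le> r Z + r X" by (rule rank_submod)
  moreover have "r (E - (Z \<inter> X)) + r (E - (Z \<union> X)) \<le> r (E - Z) + r (E - X)" by (rule submod_le) auto
  ultimately have le: "r (Z \<union> X) + r (E - (Z \<union> X)) \<le> r E + 2" using Z X_in_T by simp
  have sub: "Z \<union> X \<subseteq> E" using ZE X_sub by auto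
  have "E - (Z \<union> X) \<notin> T"
  proof
    assume "E - (Z \<union> X) \<in> T"
    moreover have "Z \<union> X \<union> (E - (Z \<union> X)) = E" using sub by auto
    ultimately show False using T_cover[OF Z(1) X_in_T(1)] by auto
  qed
  then have "Z \<union> X \<in> T" using T_or[OF sub le] by auto
  moreover have "conn M (Z \<union> X) \<le> 2" using conn_eq[OF sub] le by linarith
  ultimately have "Z \<union> X = X" by (intro X_maximal) auto
  then show ?thesis by auto
qed

text \<open>Failing this, both \<open>Z\<close> and \<open>Q\<close> are in the tangle, and with the
  singleton \<open>{x}\<close> they cover \<open>E\<close>.\<close>

lemma separation_side_in_T:
  assumes x: "x \<in> E" and Z: "Z \<subseteq> E - {x}" "Q = E - Z - {x}"
    and le: "r (insert x Z) + r Q \<le> r E + 2" "r (insert x Q) + r Z \<le> r E + 2"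
  shows "insert x Z \<in> T \<or> insert x Q \<in> T"
proof (rule ccontr)
  assume n: "\<not> ?thesis"
  have e: "E - insert x Z = Q" "E - insert x Q = Z" "insert x Z \<subseteq> E" "insert x Q \<subseteq> E" using x Z by auto
  then have "Q \<in> T" "Z \<in> T" using T_or[OF e(3)] T_or[OF e(4)] n le by auto
  moreover have "Q \<union> Z \<union> {x} = E" using e x by auto
  ultimately show False using T_cover T_single[OF x] by blast
qed

text \<open>The side whose extension by \<open>x\<close> is in the tangle meets \<open>X\<close>:
  otherwise the other side contains \<open>X - {x}\<close>, spans \<open>x\<close>, and gives a
  2-separation of \<open>M\<close>. The extended side thus shares two elements with \<open>X\<close>
  and lies inside it.\<close>

lemma deletion_separation:
  assumes x: "x \<in> X" "r (X - {x}) = r X" and Z: "Z \<subseteq> E - {x}" "Q = E - Z - {x}" "2 \<le> card Z" "2 \<le> card Q"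
    and le: "r Z + r Q \<le> r E + 1"
  shows "\<exists>P. del_separation (irk M) E X x P"
proof -
  have xE: "x \<in> E" using x X_sub by auto
  have one: "del_separation r E X x Z"
    if Z: "Z \<subseteq> E - {x}" "Q = E - Z - {x}" "2 \<le> card Z" "r Z + r Q \<le> r E + 1" "insert x Z \<in> T" for Z Q
  proof -
    have e: "E - insert x Z = Q" "E - Z = insert x Q" and ZE: "Z \<subseteq> E" using Z xE by auto
    have "Z \<inter> X \<noteq> {}"
    proof
      assume "Z \<inter> X = {}"
      then have "X - {x} \<subseteq> Q" using Z X_sub by auto
      moreover have "insert x (X - {x}) = X" using x by auto
      ultimately have "r (insert x Q) = r Q" using x(2) by (intro insert_spanned_mono[of "X - {x}"]) auto
      moreover have "2 \<le> card (E - Z)"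
      proof -
        have "card X \<le> card (E - Z)" using \<open>Z \<inter> X = {}\<close> X_sub finE by (intro card_mono) auto
        then show ?thesis using X_card by simp
      qed
      ultimately show False using three_conn[OF ZE Z(3)] Z(4) by (simp add: e(2))
    qed
    then obtain y where y: "y \<in> Z \<inter> X" by auto
    have "insert x Z \<subseteq> X"
    proof (rule T_sub_X[OF Z(5)])
      show "r (insert x Z) + r (E - insert x Z) \<le> r E + 2" using Z e rank_insert_le[of x Z] by simp
      show "x \<in> insert x Z \<inter> X" "y \<in> insert x Z \<inter> X" "x \<noteq> y" using y x Z(1) by auto
    qed
    then show ?thesis using Z by (auto simp: del_separation_def)
  qed
  have Q: "Q \<subseteq> E - {x}" "Z = E - Q - {x}" using Z by auto
  have "insert x Z \<in> T \<or> insert x Q \<in> T"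
    using rank_insert_le[of x Z] rank_insert_le[of x Q] le by (intro separation_side_in_T[OF xE Z(1,2)]) auto
  then show ?thesis using one[OF Z(1-3) le] one[OF Q Z(4)] le by (auto simp: add.commute)
qed

lemma contraction_separation:
  assumes x: "x \<in> X" "r (insert x (E - X)) = r (E - X) + 1"
    and Z: "Z \<subseteq> E - {x}" "Q = E - Z - {x}" "2 \<le> card Z" "2 \<le> card Q"
    and le: "r (insert x Z) + r (insert x Q) \<le> r E + 2"
  shows "\<exists>P. con_separation (irk M) E X x P"
proof -
  have xE: "x \<in> E" using x X_sub by auto
  have one: "con_separation r E X x Z"
    if Z: "Z \<subseteq> E - {x}" "Q = E - Z - {x}" "2 \<le> card Z" "r (insert x Z) + r (insert x Q) \<le> r E + 2"
      "insert x Z \<in> T" for Z Q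
  proof -
    have e: "E - insert x Z = Q" "E - Z = insert x Q" and ZE: "Z \<subseteq> E" using Z xE by auto
    have "Z \<inter> X \<noteq> {}"
    proof
      assume "Z \<inter> X = {}"
      then have "Z \<subseteq> E - X" using Z by auto
      then have "r (insert x Z) = r Z + 1"
        using insert_marginal_antimono[of Z "E - X" x] x(2) rank_insert_le[of x Z] by linarith
      moreover have "2 \<le> card (E - Z)"
      proof -
        have "card X \<le> card (E - Z)" using \<open>Z \<inter> X = {}\<close> X_sub finE by (intro card_mono) auto
        then show ?thesis using X_card by simp
      qed
      ultimately show False using three_conn[OF ZE Z(3)] Z(4) by (simp add: e(2))
    qed
    then obtain y where y: "y \<in> Z \<inter> X" by auto
    have "insert x Z \<subseteq> X"
    proof (rule T_sub_X[OF Z(5)])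
      show "r (insert x Z) + r (E - insert x Z) \<le> r E + 2"
        using Z(4) e rank_mono[OF subset_insertI, of Q x] by simp
      show "x \<in> insert x Z \<inter> X" "y \<in> insert x Z \<inter> X" "x \<noteq> y" using y x Z(1) by auto
    qed
    then show ?thesis using Z e by (auto simp: con_separation_def)
  qed
  have Q: "Q \<subseteq> E - {x}" "Z = E - Q - {x}" using Z by auto
  have "insert x Z \<in> T \<or> insert x Q \<in> T"
    using rank_mono[OF subset_insertI, of Q x] rank_mono[OF subset_insertI, of Z x] le
    by (intro separation_side_in_T[OF xE Z(1,2)]) auto
  then show ?thesis using one[OF Z(1-3) le] one[OF Q Z(4)] le by (auto simp: add.commute)
qed

text \<open>The two bounds follow from a 1-separation of the deletion as well as of the contraction
  of \<open>x\<close>. By 3-connectivity each side is a singleton, which leaves at most three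
  elements, while \<open>X\<close> and its complement have at least five.\<close>

lemma no_one_separation_of_removal:
  assumes x: "x \<in> E" and Z: "Z \<subseteq> E - {x}" "Q = E - Z - {x}" "1 \<le> card Z" "1 \<le> card Q"
    and le: "r Z + r (insert x Q) \<le> r E + 1" "r Q + r (insert x Z) \<le> r E + 1"
  shows False
proof -
  have e: "E - Z = insert x Q" "E - Q = insert x Z" "Z \<subseteq> E" "Q \<subseteq> E" "E = insert x (Z \<union> Q)" using x Z by auto
  have fin: "finite Z" "finite Q" using e finE finite_subset by blast+
  have "x \<notin> Z" "x \<notin> Q" using Z by auto
  have c: "card (insert x Q) = Suc (card Q)" "card (insert x Z) = Suc (card Z)"
    using fin \<open>x \<notin> Z\<close> \<open>x \<notin> Q\<close> by simp_all
  have "\<not> 2 \<le> card Z" using three_conn[OF e(3), of 2] le(1) c Z unfolding e(1) by auto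
  moreover have "\<not> 2 \<le> card Q" using three_conn[OF e(4), of 2] le(2) c Z unfolding e(2) by auto
  moreover have "card E \<le> Suc (card Z + card Q)"
    using card_insert_le_m1[of "Suc (card Z + card Q)" "Z \<union> Q" x] card_Un_le[of Z Q]
    unfolding e(5)[symmetric] by simp
  moreover have "card X + card (E - X) = card E"
    using X_sub finE by (metis card_Diff_subset card_mono finite_subset le_add_diff_inverse)
  ultimately show False using X_card card_compl_X by simp
qed

lemma deletion_not_three_connected:
  assumes x: "x \<in> X" "r (X - {x}) = r X" and n: "\<not> three_connected (deletion M x)"
  shows "\<exists>P. del_separation (irk M) E X x P"
proof -
  have xE: "x \<in> E" using x X_sub by auto
  obtain k Z where k: "1 \<le> k" "k < 3" "k_separation (deletion M x) k Z"
    using n by (auto simp: three_connected_def)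
  define Q where "Q = E - Z - {x}"
  have e: "gr (deletion M x) = E - {x}" "rk (deletion M x) = rk M" "E - {x} - Z = Q"
    by (auto simp: deletion_def gr_def rk_def Q_def)
  have Z: "Z \<subseteq> E - {x}" "k \<le> card Z" "k \<le> card Q" "rk M Z + rk M Q < rk M (E - {x}) + k"
    using k(3) unfolding k_separation_def conn_def e by auto
  have "Z \<subseteq> E" "Q \<subseteq> E" "E - {x} \<subseteq> E" using Z by (auto simp: Q_def)
  then have le: "r Z + r Q < r (E - {x}) + int k" using Z(4) by (simp add: irk_eq)
  moreover have "r (E - {x}) \<le> r E" by (rule rank_mono) auto
  ultimately have le: "r Z + r Q < r E + int k" by simp
  consider "k = 1" | "k = 2" using k by linarith
  then show ?thesis
  proof cases
    case 1
    then show ?thesis using no_one_separation_of_removal[OF xE Z(1) Q_def] Z le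
        rank_insert_le[of x Z] rank_insert_le[of x Q] by simp
  next
    case 2
    then show ?thesis using deletion_separation[OF x Z(1) Q_def] Z le by simp
  qed
qed

lemma contraction_not_three_connected:
  assumes x: "x \<in> X" "r (insert x (E - X)) = r (E - X) + 1" and n: "\<not> three_connected (contraction M x)"
  shows "\<exists>P. con_separation (irk M) E X x P"
proof -
  have xE: "x \<in> E" using x X_sub by auto
  obtain k Z where k: "1 \<le> k" "k < 3" "k_separation (contraction M x) k Z"
    using n by (auto simp: three_connected_def)
  define Q where "Q = E - Z - {x}"
  have e: "gr (contraction M x) = E - {x}" "rk (contraction M x) = (\<lambda>S. rk M (S \<union> {x}) - rk M {x})"
    "E - {x} - Z = Q" "E - {x} \<union> {x} = E"
    using xE by (auto simp: contraction_def gr_def rk_def Q_def)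
  have Z: "Z \<subseteq> E - {x}" "k \<le> card Z" "k \<le> card Q"
    "rk M (Z \<union> {x}) - rk M {x} + (rk M (Q \<union> {x}) - rk M {x}) - (rk M E - rk M {x}) < k"
    using k(3) unfolding k_separation_def conn_def e by auto
  have s: "insert x Z \<subseteq> E" "insert x Q \<subseteq> E" "{x} \<subseteq> E" using Z xE by (auto simp: Q_def)
  have ge: "r {x} \<le> r (insert x Z)" "r {x} \<le> r (insert x Q)" "r {x} \<le> r E"
    using xE by (auto intro!: rank_mono)
  have "r {x} = 1"
  proof -
    have "1 \<le> card (E - {x})" using X_card card_compl_subset[of "{x}"] x by simp
    then have "r E + 1 \<le> r {x} + r (E - {x})" using three_conn[of "{x}" 1] xE by simp
    moreover have "r (E - {x}) \<le> r E" by (rule rank_mono) auto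
    ultimately show ?thesis using rank_singleton_le[of x] by simp
  qed
  then have le: "r (insert x Z) + r (insert x Q) < r E + 1 + int k"
    using Z(4) ge irk_eq[OF s(1)] irk_eq[OF s(2)] irk_eq[OF s(3)] irk_eq[of E] by auto
  consider "k = 1" | "k = 2" using k by linarith
  then show ?thesis
  proof cases
    case 1
    then show ?thesis using no_one_separation_of_removal[OF xE Z(1) Q_def] Z le
        rank_mono[OF subset_insertI, of Z x] rank_mono[OF subset_insertI, of Q x] by simp
  next
    case 2
    then show ?thesis using contraction_separation[OF x Z(1) Q_def] Z le by simp
  qed
qed

section \<open>From rank identities back to minors\<close>

lemma is_minor_deletionI:
  assumes "C \<subseteq> E" "C \<inter> gr N = {}" "gr N \<subseteq> E" "e \<in> E" "e \<notin> C" "e \<notin> gr N"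
    and rkN: "\<And>Y. Y \<subseteq> gr N \<Longrightarrow> int (rk N Y) = r (Y \<union> C) - r C"
  shows "is_minor N (deletion M e)"
proof -
  have "rk N Y = rk M (Y \<union> C) - rk M C" if "Y \<subseteq> gr N" for Y
  proof -
    have "Y \<union> C \<subseteq> E" using that assms by auto
    then show ?thesis using rkN[OF that] irk_eq[of "Y \<union> C"] irk_eq[OF assms(1)] by linarith
  qed
  then show ?thesis unfolding is_minor_def
    by (intro exI[of _ C] exI[of _ "E - {e} - gr N - C"])
      (use assms in \<open>auto simp: deletion_def gr_def rk_def\<close>)
qed

lemma is_minor_contractionI:
  assumes "C \<subseteq> E" "C \<inter> gr N = {}" "gr N \<subseteq> E" "e \<in> C"
    and rkN: "\<And>Y. Y \<subseteq> gr N \<Longrightarrow> int (rk N Y) = r (Y \<union> C) - r C"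
  shows "is_minor N (contraction M e)"
proof -
  have "rk N Y = rk M (Y \<union> (C - {e}) \<union> {e}) - rk M {e} - (rk M (C - {e} \<union> {e}) - rk M {e})"
    if "Y \<subseteq> gr N" for Y
  proof -
    have "Y \<union> (C - {e}) \<union> {e} = Y \<union> C" "C - {e} \<union> {e} = C" using assms by auto
    moreover have "r {e} \<le> r C" "r C \<le> r (Y \<union> C)" using assms by (auto intro!: rank_mono)
    moreover have "{e} \<subseteq> E" "Y \<union> C \<subseteq> E" using that assms by auto
    then have "r {e} = int (rk M {e})" "r (Y \<union> C) = int (rk M (Y \<union> C))" by (auto intro: irk_eq)
    ultimately show ?thesis using rkN[OF that] irk_eq[OF assms(1)] by simp
  qed
  then show ?thesis unfolding is_minor_def
    by (intro exI[of _ "C - {e}"] exI[of _ "E - gr N - C"])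
      (use assms in \<open>auto simp: contraction_def gr_def rk_def\<close>)
qed

text \<open>The contraction set of \<open>N\<close> is split into \<open>CB\<close> outside
  \<open>X\<close>, a part \<open>A\<close> of \<open>{f}\<close>, and \<open>Cs\<close> inside
  \<open>X - {f}\<close>. Only \<open>Cs\<close> varies: contracting it and deleting the rest of
  \<open>X - {f}\<close> gives N_0, from which \<open>N\<close> arises by contracting
  \<open>CB\<close> and \<open>A\<close>, whichever member of \<open>G\<close> represents
  N_0.\<close>

lemma removable_of_linked:
  assumes f: "f \<in> X" and N: "gr N \<subseteq> E" "(X - {f}) \<inter> gr N = {}"
    and CB: "CB \<subseteq> E - X" "CB \<inter> gr N = {}" and A: "A \<subseteq> {f}" "A \<inter> gr N = {}"
    and Cs: "Cs \<subseteq> X - {f}" "r (insert f Cs) = r Cs + 1"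
      "r (insert f ((E - X) \<union> Cs)) = r ((E - X) \<union> Cs)"
    and rkN: "\<And>Y. Y \<subseteq> gr N \<Longrightarrow> int (rk N Y) = r (Y \<union> (CB \<union> A \<union> Cs)) - r (CB \<union> A \<union> Cs)"
  shows "\<exists>e \<in> X - {f}.
           (three_connected (deletion M e) \<and> is_minor N (deletion M e))
         \<or> (three_connected (contraction M e) \<and> is_minor N (contraction M e))"
proof (rule ccontr)
  assume no: "\<not> ?thesis"
  define G where "G = {C. C \<subseteq> X - {f} \<and>
    (\<forall>Y \<subseteq> insert f (E - X). r (Y \<union> C) + r Cs = r (Y \<union> Cs) + r C)}"
  have GI: "C \<in> G" if "C \<subseteq> X - {f}" "\<And>Y. Y \<subseteq> insert f (E - X) \<Longrightarrow> r (Y \<union> C) + r Cs = r (Y \<union> Cs) + r C" for C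
    using that by (simp add: G_def)
  have GD: "C \<subseteq> X - {f}" "Y \<subseteq> insert f (E - X) \<Longrightarrow> r (Y \<union> C) + r Cs = r (Y \<union> Cs) + r C" if "C \<in> G" for C Y
    using that by (auto simp: G_def)
  have NX: "gr N \<subseteq> insert f (E - X)" using N by auto
  have rkG: "int (rk N Y) = r (Y \<union> (CB \<union> A \<union> C)) - r (CB \<union> A \<union> C)" if "C \<in> G" "Y \<subseteq> gr N" for C Y
  proof -
    have "Y \<union> (CB \<union> A) \<subseteq> insert f (E - X)" "CB \<union> A \<subseteq> insert f (E - X)" using that NX CB A by auto
    then show ?thesis using rkN[OF that(2)] GD(2)[OF that(1), of "Y \<union> (CB \<union> A)"] GD(2)[OF that(1), of "CB \<union> A"]
      by (simp add: Un_assoc)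
  qed
  have side: "CB \<union> A \<union> C \<subseteq> E" "(CB \<union> A \<union> C) \<inter> gr N = {}" if "C \<in> G" for C
    using GD(1)[OF that] CB A N f X_sub by auto
  have del: "\<not> three_connected (deletion M x)" if "C \<in> G" "x \<in> X - {f}" "x \<notin> C" for C x
  proof -
    have "is_minor N (deletion M x)"
      using side[OF that(1)] rkG[OF that(1)] N X_sub that CB A by (intro is_minor_deletionI[of "CB \<union> A \<union> C"]) auto
    then show ?thesis using no that by blast
  qed
  have con: "\<not> three_connected (contraction M x)" if "C \<in> G" "x \<in> C" for C x
  proof -
    have "is_minor N (contraction M x)"
      using side[OF that(1)] rkG[OF that(1)] N that by (intro is_minor_contractionI[of "CB \<union> A \<union> C"]) auto
    moreover have "x \<in> X - {f}" using GD(1)[OF that(1)] that by auto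
    ultimately show ?thesis using no by blast
  qed
  have "obstruction (irk M) E X f G"
  proof
    show "finite E" "X \<subseteq> E" "f \<in> X" "3 \<le> card X" by (rule finE X_sub f X_card)+
    show "r X + r (E - X) \<le> r E + 2" using X_in_T by simp
    have "Cs \<in> G" using Cs by (intro GI) auto
    then show "G \<noteq> {}" by auto
  next
    fix Y assume "Y \<subseteq> X" "2 \<le> card Y"
    then show "r E + 2 \<le> r Y + r (E - Y)" using three_conn[of Y 2] card_compl_subset[of Y] X_sub by auto
  next
    fix x assume "x \<in> X"
    then show "r E + 1 \<le> r {x} + r (E - {x})" using three_conn[of "{x}" 1] card_compl_subset[of "{x}"] X_sub by auto
  next
    fix C assume C: "C \<in> G"
    show "C \<subseteq> X - {f}" by (rule GD(1)[OF C])
    have "r ({f} \<union> C) + r Cs = r ({f} \<union> Cs) + r C" by (rule GD(2)[OF C]) auto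
    then show "r (insert f C) = r C + 1" using Cs by simp
    have "r (insert f (E - X) \<union> C) + r Cs = r (insert f (E - X) \<union> Cs) + r C"
      "r ((E - X) \<union> C) + r Cs = r ((E - X) \<union> Cs) + r C" by (rule GD(2)[OF C]; auto)+
    then show "r (insert f (E - X \<union> C)) = r (E - X \<union> C)" using Cs by simp
  next
    fix C C' assume C: "C \<in> G" "C' \<subseteq> X - {f}"
      and eq: "\<And>Y. Y \<subseteq> insert f (E - X) \<Longrightarrow> r (Y \<union> C') + r C = r (Y \<union> C) + r C'"
    show "C' \<in> G"
    proof (rule GI[OF C(2)])
      fix Y assume Y: "Y \<subseteq> insert f (E - X)"
      show "r (Y \<union> C') + r Cs = r (Y \<union> Cs) + r C'" using GD(2)[OF C(1) Y] eq[OF Y] by linarith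
    qed
  next
    fix C x assume "C \<in> G" "x \<in> X - {f}" "x \<notin> C" "r (X - {x}) = r X"
    then show "\<exists>P. del_separation (irk M) E X x P" using del deletion_not_three_connected by auto
  next
    fix C x assume "C \<in> G" "x \<in> C" "r (insert x (E - X)) = r (E - X) + 1"
    then show "\<exists>P. con_separation (irk M) E X x P" using con contraction_not_three_connected GD(1) by blast
  qed
  then show False by (rule obstruction.inconsistent)
qed

end

theorem theorem3p1:
  fixes M N :: "'a matroid" and \<theta> :: nat and T :: "'a set set" and X :: "'a set" and f :: 'a
  assumes "matroid M"
    and "three_connected M"
    and "is_minor N M"
    and "\<forall>e\<in>gr N. \<not> loop N e \<and> \<not> coloop N e"
    and "tangle M \<theta> T" and "3 \<le> \<theta>"
    and "long_line (tangle_matroid M \<theta> T) X"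
    and "f \<in> X"
    and "(X - {f}) \<inter> gr N = {}"
  shows "\<exists>e \<in> X - {f}.
           (three_connected (deletion M e) \<and> is_minor N (deletion M e))
         \<or> (three_connected (contraction M e) \<and> is_minor N (contraction M e))"
proof -
  interpret tangle_line M \<theta> T X using assms by unfold_locales
  let ?E = "gr M" and ?r = "irk M"
  obtain C D where CD: "C \<inter> D = {}" "C \<union> D \<subseteq> ?E" "gr N = ?E - (C \<union> D)"
    "\<forall>Y. Y \<subseteq> gr N \<longrightarrow> rk N Y = rk M (Y \<union> C) - rk M C"
    using assms(3) unfolding is_minor_def by blast
  have rkN: "int (rk N Y) = ?r (Y \<union> C) - ?r C" if "Y \<subseteq> gr N" for Y
  proof -
    have "Y \<union> C \<subseteq> ?E" "C \<subseteq> ?E" using that CD by auto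
    then show ?thesis using CD(4) that irk_eq[of "Y \<union> C"] irk_eq[of C] rank_mono[of C "Y \<union> C"] by auto
  qed
  define CB where "CB = C - X"
  have CB: "CB \<subseteq> ?E - X" "CB \<inter> gr N = {}" and NE: "gr N \<subseteq> ?E" using CD by (auto simp: CB_def)
  have Csplit: "CB \<union> {} \<union> (C \<inter> X) = C" by (auto simp: CB_def)
  show ?thesis
  proof (cases "f \<in> gr N")
    case True
    have fC: "f \<notin> C" using True CD by auto
    show ?thesis
    proof (rule removable_of_linked[OF assms(8) NE assms(9) CB, of "{}" "C \<inter> X"])
      show "C \<inter> X \<subseteq> X - {f}" using fC by auto
      have "\<not> loop N f" "\<not> coloop N f" using assms(4) True by auto
      then have nl: "rk N {f} \<noteq> 0" and nc: "rk N (gr N) \<le> rk N (gr N - {f})"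
        using True by (auto simp: loop_def coloop_def)
      have "?r C < ?r (insert f C)" using rkN[of "{f}"] nl True by auto
      moreover have "?r (insert f C) + ?r (C \<inter> X) \<le> ?r (insert f (C \<inter> X)) + ?r C"
        by (rule insert_marginal_antimono) auto
      ultimately show "?r (insert f (C \<inter> X)) = ?r (C \<inter> X) + 1"
        using rank_insert_le[of f "C \<inter> X"] by linarith
      have "?r (gr N \<union> C) \<le> ?r (gr N - {f} \<union> C)"
        using rkN[of "gr N"] rkN[of "gr N - {f}"] nc by auto
      moreover have "insert f (gr N - {f} \<union> C) = gr N \<union> C" using True by auto
      ultimately have "?r (insert f (gr N - {f} \<union> C)) \<le> ?r (gr N - {f} \<union> C)" by simp
      \<comment> \<open>As \<open>E(N)\<close> minus \<open>f\<close> avoids \<open>X\<close>, the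
        set that spans \<open>f\<close> lies in
        \<open>(E - X) \<union> (C \<inter> X)\<close>.\<close>
      then show "?r (insert f ((?E - X) \<union> (C \<inter> X))) = ?r ((?E - X) \<union> (C \<inter> X))"
        using assms(9) NE CD by (intro insert_spanned_mono[of "gr N - {f} \<union> C"]) auto
    qed (use rkN Csplit in auto)
  next
    case False
    have NX: "gr N \<subseteq> ?E - X" using False assms(9) NE by auto
    have "?r ?E < ?r F + ?r (?E - F)" if "f \<in> F" "F \<subseteq> X" for F
    proof -
      have FE: "F \<subseteq> ?E" "F \<noteq> {}" using that X_sub by auto
      then have "1 \<le> card F" using finite_subset[OF _ finE] card_gt_0_iff[of F] by fastforce
      then have "?r ?E + int 1 \<le> ?r F + ?r (?E - F)"
        using card_compl_subset[OF that(2)] by (intro three_conn[OF FE(1)]) auto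
      then show ?thesis by simp
    qed
    note linked = linking_with_fixed_contraction[OF rank_function_axioms finE X_sub assms(8), of "C \<inter> X", OF _ this]
    obtain Cs A where Cs: "Cs \<subseteq> X - {f}" "?r (insert f Cs) = ?r Cs + 1"
      "?r ((?E - X) \<union> insert f Cs) = ?r ((?E - X) \<union> Cs)" "A = {} \<or> A = {f}"
      "\<forall>Y \<subseteq> ?E - X. ?r (Y \<union> (Cs \<union> A)) + ?r (C \<inter> X) = ?r (Y \<union> (C \<inter> X)) + ?r (Cs \<union> A)"
      using linked by blast
    show ?thesis
    proof (rule removable_of_linked[OF assms(8) NE assms(9) CB, of A Cs])
      show "A \<subseteq> {f}" "A \<inter> gr N = {}" "Cs \<subseteq> X - {f}" "?r (insert f Cs) = ?r Cs + 1"
        "?r (insert f ((?E - X) \<union> Cs)) = ?r ((?E - X) \<union> Cs)" using Cs False by auto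
      fix Y assume Y: "Y \<subseteq> gr N"
      \<comment> \<open>Linking preserves the ranks of all subsets of \<open>E - X\<close>, so
        \<open>CB\<close> can be moved into the set being measured.\<close>
      have "Y \<union> CB \<subseteq> ?E - X" using Y NX CB by auto
      then have "?r ((Y \<union> CB) \<union> (Cs \<union> A)) + ?r (C \<inter> X) = ?r ((Y \<union> CB) \<union> (C \<inter> X)) + ?r (Cs \<union> A)"
        "?r (CB \<union> (Cs \<union> A)) + ?r (C \<inter> X) = ?r (CB \<union> (C \<inter> X)) + ?r (Cs \<union> A)"
        using Cs(5) CB(1) by blast+
      moreover have "(Y \<union> CB) \<union> (Cs \<union> A) = Y \<union> (CB \<union> A \<union> Cs)" "CB \<union> (Cs \<union> A) = CB \<union> A \<union> Cs"
        "(Y \<union> CB) \<union> (C \<inter> X) = Y \<union> C" "CB \<union> (C \<inter> X) = C" by (auto simp: CB_def)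
      ultimately show "int (rk N Y) = ?r (Y \<union> (CB \<union> A \<union> Cs)) - ?r (CB \<union> A \<union> Cs)"
        using rkN[OF Y] by simp
    qed
  qed
qed

end
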